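(* Let $\delta\in(0,1)$. For every integer $k\ge 2$ there exists $\epsilon>0$ such that the following holds. Let $p=p(n)$ and $q=q(n)$ be positive reals such that (i) $\max\{p,q\}\le 1-\delta$, and (ii) $pq\le \epsilon\,\dfrac{\log n}{n^{k-1}}$. Let $G_1\in\mathcal G(n,k,p)$ and $G_2\in\mathcal G(n,k,q)$ be independent random $k$-uniform hypergraphs of order $n$. Then, with high probability, there is a packing of $G_1$ and $G_2$.
   Context: For integers $k,n$ and $p\in[0,1]$, $\mathcal G(n,k,p)$ denotes the random $k$-uniform hypergraph on $n$ vertices in which each of the $\binom nk$ possible edges ($k$-subsets of the vertex set) is present independently with probability $p$. Two $k$-uniform hypergraphs $G_1,G_2$ of order $n$ (i.e. with $n$ vertices) can be packed (there is a packing of $G_1$ and $G_2$) if they can be placed onto the same vertex set so that their edge sets are disjoint; equivalently, there is a bijection $\phi:V(G_1)\to V(G_2)$ such that no edge of $G_1$ is mapped by $\phi$ to an edge of $G_2$. "With high probability" means with probability $1-o(1)$ as $n\to\infty$. $\log$ is the natural logarithm. Here $p,q$ are functions of the integer $n\ge 2$, and the conditions on them are required for every such $n$. *)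

theory Defs
  imports "HOL-Probability.Probability" "HOL-Library.Ramsey"
begin

text \<open>A hypergraph is a pair consisting of its vertex set and its edge set.\<close>

type_synonym 'a hypergraph = "'a set \<times> 'a set set"

definition packing :: "('a \<Rightarrow> 'b) \<Rightarrow> 'a hypergraph \<Rightarrow> 'b hypergraph \<Rightarrow> bool" where
  "packing \<phi> G\<^sub>1 G\<^sub>2 \<longleftrightarrow>
     bij_betw \<phi> (fst G\<^sub>1) (fst G\<^sub>2) \<and> (\<forall>e\<in>snd G\<^sub>1. \<phi> ` e \<notin> snd G\<^sub>2)"

definition can_be_packed :: "'a hypergraph \<Rightarrow> 'b hypergraph \<Rightarrow> bool" where
  "can_be_packed G\<^sub>1 G\<^sub>2 \<longleftrightarrow> (\<exists>\<phi>. packing \<phi> G\<^sub>1 G\<^sub>2)"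

text \<open>
  The binomial random hypergraph on the vertex set \<open>{..<n}\<close>: one independent Bernoulli
  indicator for each \<open>k\<close>-subset. Only values \<open>p\<close> in the unit interval are meaningful.
\<close>

definition random_hypergraph :: "nat \<Rightarrow> nat \<Rightarrow> real \<Rightarrow> nat hypergraph pmf" where
  "random_hypergraph n k p =
     map_pmf (\<lambda>present. ({..<n}, {e \<in> nsets {..<n} k. present e}))
       (Pi_pmf (nsets {..<n} k) False (\<lambda>_. bernoulli_pmf p))"

end

theory Submission
  imports Defs "HOL-Real_Asymp.Real_Asymp"
begin

text \<open>
  The vertices of the two hypergraphs are identified block by block. Suppose that a bijection
  between two \<open>w\<close>-element vertex sets has been found under which the edges inside these sets do
  not collide, and let \<open>N\<close> be a block of further vertices, whose size is a small power of \<open>n\<close>.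
  Whether the edges that meet \<open>N\<close> are present is independent of everything used so far. After
  relabelling the second hypergraph, the old bijection may therefore be taken to be the identity on a
  set \<open>W\<close> (\<open>prob_unpackable_extend\<close>), and it suffices that the identity on \<open>W\<close> extends to a packing
  on \<open>W \<union> N\<close> with failure probability \<open>o(1/n)\<close>, since there are at most \<open>n\<close> blocks. By symmetry
  \<open>p \<le> q\<close>, so that \<open>p\<close> is at most about \<open>n\<close> to the power \<open>-(k-1)/2\<close>.

  First consider the edges with exactly one vertex in \<open>N\<close>. A new vertex \<open>a\<close> of the first hypergraph
  has a link \<open>D\<^sub>a\<close>, a random set of \<open>(k-1)\<close>-subsets of \<open>W\<close>, and a new vertex \<open>b\<close> of the second one a
  link \<open>L\<^sub>b\<close>. Sending \<open>a\<close> to \<open>b\<close> causes no collision iff \<open>D\<^sub>a\<close> and \<open>L\<^sub>b\<close> are disjoint. Given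
  \<open>D\<^sub>a\<close>, this has probability \<open>(1-q)\<close> to the power \<open>|D\<^sub>a|\<close>, which for small \<open>\<epsilon>\<close> is at least an
  arbitrarily small negative power \<open>1/t\<close> of \<open>n\<close>. The block is cut into subblocks of size \<open>m\<close>, and
  the compatibility graph between any two of them has a perfect matching: all its degrees are
  large, and any two sets of moderate size are joined by an edge, which is enough
  (\<open>perfect_matching_if_expanding\<close>). For these two properties the links \<open>L\<^sub>b\<close> are used as independent
  random sets; a single \<open>L\<^sub>b\<close> meets the different \<open>D\<^sub>a\<close> almost independently, because the
  \<open>D\<^sub>a\<close> overlap so little that \<open>L\<^sub>b\<close> contains only boundedly many elements of the overlap
  (\<open>scattered\<close>, \<open>prob_hit_scattered_le\<close>, \<open>prob_no_matching_le\<close>, \<open>prob_not_scattered_le\<close>).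

  The edges with at least two vertices in \<open>N\<close> are independent of the choice of these matchings. One
  extension of the identity has a collision among them with probability about \<open>1/n\<close> up to a small
  power of \<open>n\<close>, which is slightly too much. But the matchings between all pairs of subblocks give
  \<open>t\<close> extensions, one for each cyclic shift of the subblocks, and no edge has the same image under
  two of them (\<open>cyclic_shift_maps\<close>). If all of them have a collision, then either one edge has all
  its \<open>t\<close> images present, or two different edges are involved; both are sufficiently unlikely
  (\<open>prob_all_maps_conflict_le\<close>).

  Everything is combined in \<open>prob_no_extension_fixing_old_le\<close>; the parameters are powers of an integer
  \<open>t\<close>, which is about \<open>n\<close> to the power \<open>1/(100k)\<close>, and the total failure probability is at
  most \<open>12/t\<close> (\<open>prob_unpackable_le\<close>).
\<close>

section \<open>Probability estimates for discrete distributions\<close>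

lemma prob_le_if:
  fixes M :: "'a pmf"
  assumes "\<And>x. x \<in> set_pmf M \<Longrightarrow> x \<in> P \<Longrightarrow> x \<in> Q"
  shows "measure_pmf.prob M P \<le> measure_pmf.prob M Q"
  using assms by (intro measure_pmf.finite_measure_mono_AE) (auto simp: AE_measure_pmf_iff)

lemma prob_union_bound:
  fixes M :: "'a pmf"
  assumes "finite I" and "\<And>x. x \<in> set_pmf M \<Longrightarrow> x \<in> P \<Longrightarrow> \<exists>i\<in>I. x \<in> Q i"
  shows "measure_pmf.prob M P \<le> (\<Sum>i\<in>I. measure_pmf.prob M (Q i))"
proof -
  have "measure_pmf.prob M P \<le> measure_pmf.prob M (\<Union>i\<in>I. Q i)"
    using assms(2) by (intro prob_le_if) auto
  also have "\<dots> \<le> (\<Sum>i\<in>I. measure_pmf.prob M (Q i))"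
    using assms(1) by (intro measure_pmf.finite_measure_subadditive_finite) auto
  finally show ?thesis .
qed

lemma prob_union_bound_card:
  fixes M :: "'a pmf" and c :: real
  assumes "finite I" and "\<And>x. x \<in> set_pmf M \<Longrightarrow> x \<in> P \<Longrightarrow> \<exists>i\<in>I. x \<in> Q i"
    and "\<And>i. i \<in> I \<Longrightarrow> measure_pmf.prob M (Q i) \<le> c"
  shows "measure_pmf.prob M P \<le> card I * c"
proof -
  have "(\<Sum>i\<in>I. measure_pmf.prob M (Q i)) \<le> card I * c"
    using sum_bounded_above[of I "\<lambda>i. measure_pmf.prob M (Q i)" c] assms(3) by simp
  with prob_union_bound[OF assms(1,2)] show ?thesis by fastforce
qed

lemma prob_le_Un:
  fixes M :: "'a pmf" and a b :: real
  assumes "\<And>x. x \<in> set_pmf M \<Longrightarrow> x \<in> P \<Longrightarrow> x \<in> Q \<or> x \<in> R"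
    and "measure_pmf.prob M Q \<le> a" and "measure_pmf.prob M R \<le> b"
  shows "measure_pmf.prob M P \<le> a + b"
proof -
  have "measure_pmf.prob M P \<le> measure_pmf.prob M (Q \<union> R)"
    using assms(1) by (intro prob_le_if) auto
  also have "\<dots> \<le> measure_pmf.prob M Q + measure_pmf.prob M R"
    by (rule measure_Un_le) auto
  finally show ?thesis using assms(2,3) by linarith
qed

lemma prob_markov:
  fixes M :: "'a pmf" and f :: "'a \<Rightarrow> real"
  assumes "finite (set_pmf M)" and "\<And>x. x \<in> set_pmf M \<Longrightarrow> 0 \<le> f x" and "0 < c"
  shows "measure_pmf.prob M {x. c \<le> f x} \<le> measure_pmf.expectation M f / c"
proof -
  have "c * measure_pmf.prob M {x. c \<le> f x}
      = measure_pmf.expectation M (\<lambda>x. c * indicator {x. c \<le> f x} x)"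
    by simp
  also have "\<dots> \<le> measure_pmf.expectation M f"
    using assms by (intro integral_mono_AE)
      (auto intro!: integrable_measure_pmf_finite simp: AE_measure_pmf_iff indicator_def)
  finally show ?thesis using assms(3) by (simp add: pos_le_divide_eq mult.commute)
qed

text \<open>
  This is the tool for exposing two independent sources of randomness one after the other: the second
  one only has to behave well if the outcome of the first one is not bad.
\<close>

lemma prob_pair_le:
  fixes A :: "'a pmf" and B :: "'b pmf" and c :: real
  assumes "0 \<le> c" and "\<And>x. x \<in> set_pmf A \<Longrightarrow> x \<notin> Bad \<Longrightarrow> measure_pmf.prob B {y. (x, y) \<in> Q} \<le> c"
  shows "measure_pmf.prob (pair_pmf A B) Q \<le> measure_pmf.prob A Bad + c"
proof -
  have "emeasure (pair_pmf A B) Q = (\<integral>\<^sup>+x. emeasure B {y. (x, y) \<in> Q} \<partial>A)"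
    unfolding pair_pmf_def emeasure_bind_pmf map_pmf_def[symmetric]
    by (intro nn_integral_cong) (simp add: vimage_def)
  also have "\<dots> \<le> (\<integral>\<^sup>+x. indicator Bad x + ennreal c \<partial>A)"
  proof (intro nn_integral_mono_AE, unfold AE_measure_pmf_iff, intro ballI)
    fix x assume x: "x \<in> set_pmf A"
    show "emeasure B {y. (x, y) \<in> Q} \<le> indicator Bad x + ennreal c"
    proof (cases "x \<in> Bad")
      case True
      have "emeasure B {y. (x, y) \<in> Q} \<le> 1 + 0"
        using measure_pmf.emeasure_le_1 by simp
      also have "\<dots> \<le> 1 + ennreal c"
        by (intro add_left_mono) simp
      finally show ?thesis using True by simp
    next
      case False
      thus ?thesis
        using assms(2)[OF x] by (simp add: measure_pmf.emeasure_eq_measure ennreal_leI)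
    qed
  qed
  also have "\<dots> = emeasure A Bad + ennreal c"
    by (subst nn_integral_add) auto
  finally show ?thesis
    using assms(1) unfolding measure_pmf.emeasure_eq_measure
    by (subst (asm) ennreal_plus[symmetric]) (auto simp del: ennreal_plus)
qed

section \<open>Random subsets of a finite set\<close>

definition random_subset :: "'a set \<Rightarrow> real \<Rightarrow> 'a set pmf" where
  "random_subset E p = map_pmf (\<lambda>f. {e \<in> E. f e}) (Pi_pmf E False (\<lambda>_. bernoulli_pmf p))"

lemma set_pmf_random_subset: "R \<in> set_pmf (random_subset E p) \<Longrightarrow> R \<subseteq> E"
  by (auto simp: random_subset_def)

lemma finite_set_pmf_random_subset: "finite E \<Longrightarrow> finite (set_pmf (random_subset E p))"
  by (rule finite_subset[of _ "Pow E"]) (auto dest: set_pmf_random_subset)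

lemma random_subset_empty [simp]: "random_subset {} p = return_pmf {}"
  by (simp add: random_subset_def)

lemma random_subset_Un:
  assumes "finite E" "finite F" "E \<inter> F = {}"
  shows "random_subset (E \<union> F) p
    = map_pmf (\<lambda>(X, Y). X \<union> Y) (pair_pmf (random_subset E p) (random_subset F p))"
proof -
  have "random_subset (E \<union> F) p = map_pmf (\<lambda>(f, g). {e \<in> E. f e} \<union> {e \<in> F. g e})
      (pair_pmf (Pi_pmf E False (\<lambda>_. bernoulli_pmf p)) (Pi_pmf F False (\<lambda>_. bernoulli_pmf p)))"
    unfolding random_subset_def Pi_pmf_union[OF assms] pmf.map_comp
    by (intro map_pmf_cong) (use assms(3) in \<open>auto simp: o_def split: if_splits\<close>)
  also have "\<dots> = map_pmf (\<lambda>(X, Y). X \<union> Y) (pair_pmf (random_subset E p) (random_subset F p))"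
    unfolding random_subset_def map_pair[symmetric] pmf.map_comp
    by (intro map_pmf_cong) auto
  finally show ?thesis .
qed

lemma random_subset_singleton:
  "random_subset {x} p = map_pmf (\<lambda>b. if b then {x} else {}) (bernoulli_pmf p)"
  unfolding random_subset_def Pi_pmf_singleton pmf.map_comp
  by (intro map_pmf_cong) auto

lemma random_subset_Int:
  assumes "finite E" "F \<subseteq> E"
  shows "map_pmf (\<lambda>R. R \<inter> F) (random_subset E p) = random_subset F p"
proof -
  have fin: "finite F" using assms finite_subset by blast
  have "random_subset E p = map_pmf (\<lambda>(X, Y). X \<union> Y) (pair_pmf (random_subset F p) (random_subset (E - F) p))"
    using random_subset_Un[of F "E - F" p] assms fin by (simp add: Un_absorb1)
  hence "map_pmf (\<lambda>R. R \<inter> F) (random_subset E p)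
      = map_pmf (\<lambda>(X, Y). (X \<union> Y) \<inter> F) (pair_pmf (random_subset F p) (random_subset (E - F) p))"
    by (simp add: pmf.map_comp o_def case_prod_unfold)
  also have "\<dots> = map_pmf fst (pair_pmf (random_subset F p) (random_subset (E - F) p))"
    by (intro map_pmf_cong) (auto dest!: set_pmf_random_subset)
  finally show ?thesis by (simp add: map_fst_pair_pmf)
qed

text \<open>
  The trace of a random subset on \<open>F\<close> is a random subset of \<open>F\<close>, so events that depend on
  the trace only may be computed there.
\<close>

lemma prob_random_subset_Int:
  assumes "finite E" "F \<subseteq> E"
  shows "measure_pmf.prob (random_subset E p) {R. R \<inter> F \<in> Q} = measure_pmf.prob (random_subset F p) Q"
  by (simp add: random_subset_Int[OF assms, symmetric] vimage_def)

lemma random_subset_image: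
  assumes "finite E" "inj_on h E"
  shows "map_pmf ((`) h) (random_subset E p) = random_subset (h ` E) p"
  using assms
proof (induction E rule: finite_induct)
  case (insert x E)
  have "map_pmf ((`) h) (random_subset (insert x E) p)
      = map_pmf (\<lambda>(X, Y). h ` X \<union> h ` Y) (pair_pmf (random_subset {x} p) (random_subset E p))"
    using insert.hyps random_subset_Un[of "{x}" E p]
    by (simp add: pmf.map_comp o_def case_prod_unfold image_Un)
  also have "\<dots> = map_pmf (\<lambda>(X, Y). X \<union> Y)
      (map_pmf (\<lambda>(X, Y). (h ` X, h ` Y)) (pair_pmf (random_subset {x} p) (random_subset E p)))"
    by (simp add: pmf.map_comp o_def case_prod_unfold)
  also have "\<dots> = map_pmf (\<lambda>(X, Y). X \<union> Y)
      (pair_pmf (map_pmf ((`) h) (random_subset {x} p)) (map_pmf ((`) h) (random_subset E p)))"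
    unfolding map_pair ..
  also have "map_pmf ((`) h) (random_subset {x} p) = random_subset {h x} p"
    unfolding random_subset_singleton pmf.map_comp by (intro map_pmf_cong) auto
  also have "map_pmf ((`) h) (random_subset E p) = random_subset (h ` E) p"
    using insert by auto
  also have "map_pmf (\<lambda>(X, Y). X \<union> Y) (pair_pmf (random_subset {h x} p) (random_subset (h ` E) p))
      = random_subset (h ` insert x E) p"
    using insert random_subset_Un[of "{h x}" "h ` E" p] by auto
  finally show ?case .
qed simp

text \<open>
  Random subsets are invariant under relabelling; with \<open>h\<close> a bijection of \<open>E\<close> onto itself this
  is the symmetry that permits normalising the packing of the old vertices to the identity.
\<close>

lemma prob_random_subset_image:
  assumes "finite E" "inj_on h E"
  shows "measure_pmf.prob (random_subset (h ` E) p) Q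
    = measure_pmf.prob (random_subset E p) {R. h ` R \<in> Q}"
  by (simp add: random_subset_image[OF assms, symmetric] vimage_def)

lemma prob_pair_Times:
  "measure_pmf.prob (pair_pmf A B) {(x, y). x \<in> P \<and> y \<in> Q} = measure_pmf.prob A P * measure_pmf.prob B Q"
proof -
  have "measure_pmf.prob (pair_pmf A B) {(x, y). x \<in> P \<and> y \<in> Q}
      = measure_pmf.prob (pair_pmf A B) ((P \<inter> set_pmf A) \<times> (Q \<inter> set_pmf B))"
    by (rule measure_pmf.finite_measure_eq_AE) (auto simp: AE_measure_pmf_iff)
  also have "\<dots> = measure_pmf.prob A P * measure_pmf.prob B Q"
    by (subst measure_pmf_prob_product) (auto simp: measure_Int_set_pmf)
  finally show ?thesis .
qed

lemma prob_random_subset_indep: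
  assumes "finite I" "\<And>i. i \<in> I \<Longrightarrow> finite (E i)" "disjoint_family_on E I" "(\<Union>i\<in>I. E i) \<subseteq> V" "finite V"
  shows "measure_pmf.prob (random_subset V p) {R. \<forall>i\<in>I. R \<inter> E i \<in> Q i}
    = (\<Prod>i\<in>I. measure_pmf.prob (random_subset (E i) p) (Q i))"
proof -
  have "measure_pmf.prob (random_subset (\<Union>i\<in>I. E i) p) {R. \<forall>i\<in>I. R \<inter> E i \<in> Q i}
    = (\<Prod>i\<in>I. measure_pmf.prob (random_subset (E i) p) (Q i))"
    using assms(1-3)
  proof (induction I rule: finite_induct)
    case (insert i I)
    have disj: "E i \<inter> E j = {}" if "j \<in> I" for j
      using disjoint_family_onD[OF insert.prems(2), of i j] insert.hyps(2) that by auto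
    have "random_subset (\<Union>j\<in>insert i I. E j) p = map_pmf (\<lambda>(X, Y). X \<union> Y)
        (pair_pmf (random_subset (E i) p) (random_subset (\<Union>j\<in>I. E j) p))"
    proof -
      have "E i \<inter> (\<Union>j\<in>I. E j) = {}" using disj by auto
      from random_subset_Un[OF _ _ this, of p] show ?thesis
        using insert.hyps(1) insert.prems(1) by simp
    qed
    hence "measure_pmf.prob (random_subset (\<Union>j\<in>insert i I. E j) p) {R. \<forall>j\<in>insert i I. R \<inter> E j \<in> Q j}
      = measure_pmf.prob (pair_pmf (random_subset (E i) p) (random_subset (\<Union>j\<in>I. E j) p))
          {(X, Y). \<forall>j\<in>insert i I. (X \<union> Y) \<inter> E j \<in> Q j}"
      by (simp add: vimage_def case_prod_unfold)
    also have "\<dots> = measure_pmf.prob (pair_pmf (random_subset (E i) p) (random_subset (\<Union>j\<in>I. E j) p))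
          {(X, Y). X \<in> Q i \<and> Y \<in> {Y. \<forall>j\<in>I. Y \<inter> E j \<in> Q j}}"
    proof (intro measure_pmf.finite_measure_eq_AE)
      have "(\<forall>j\<in>insert i I. (X \<union> Y) \<inter> E j \<in> Q j) \<longleftrightarrow> X \<in> Q i \<and> (\<forall>j\<in>I. Y \<inter> E j \<in> Q j)"
        if "X \<subseteq> E i" "Y \<subseteq> (\<Union>j\<in>I. E j)" for X Y
      proof -
        have "(X \<union> Y) \<inter> E i = X" using that disj by auto
        moreover have "(X \<union> Y) \<inter> E j = Y \<inter> E j" if "j \<in> I" for j
          using disj[OF that] \<open>X \<subseteq> E i\<close> by auto
        ultimately show ?thesis by auto
      qed
      thus "AE x in measure_pmf (pair_pmf (random_subset (E i) p) (random_subset (\<Union>j\<in>I. E j) p)).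
          (x \<in> {(X, Y). \<forall>j\<in>insert i I. (X \<union> Y) \<inter> E j \<in> Q j}) =
          (x \<in> {(X, Y). X \<in> Q i \<and> Y \<in> {Y. \<forall>j\<in>I. Y \<inter> E j \<in> Q j}})"
        by (auto simp: AE_measure_pmf_iff dest!: set_pmf_random_subset)
    qed auto
    also have "\<dots> = measure_pmf.prob (random_subset (E i) p) (Q i) *
        measure_pmf.prob (random_subset (\<Union>j\<in>I. E j) p) {Y. \<forall>j\<in>I. Y \<inter> E j \<in> Q j}"
      by (rule prob_pair_Times)
    also have "measure_pmf.prob (random_subset (\<Union>j\<in>I. E j) p) {Y. \<forall>j\<in>I. Y \<inter> E j \<in> Q j}
        = (\<Prod>j\<in>I. measure_pmf.prob (random_subset (E j) p) (Q j))"
      using insert.prems by (intro insert.IH) (auto intro: disjoint_family_on_mono[of I "insert i I"])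
    finally show ?case using insert.hyps by simp
  qed simp
  moreover have "measure_pmf.prob (random_subset V p) {R. \<forall>i\<in>I. R \<inter> E i \<in> Q i}
    = measure_pmf.prob (random_subset (\<Union>i\<in>I. E i) p) {R. \<forall>i\<in>I. R \<inter> E i \<in> Q i}"
  proof -
    have "R \<inter> (\<Union>i\<in>I. E i) \<inter> E j = R \<inter> E j" if "j \<in> I" for R j using that by blast
    hence "{R. \<forall>i\<in>I. R \<inter> E i \<in> Q i} = {R. R \<inter> (\<Union>i\<in>I. E i) \<in> {R. \<forall>i\<in>I. R \<inter> E i \<in> Q i}}"
      by simp
    from arg_cong[OF this, of "measure_pmf.prob (random_subset V p)"] show ?thesis
      by (simp only: prob_random_subset_Int[OF assms(5,4)])
  qed
  ultimately show ?thesis by simp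
qed

context
  fixes p :: real
  assumes p: "0 \<le> p" "p \<le> 1"
begin

lemma prob_random_subset_superset:
  assumes "finite E" "F \<subseteq> E"
  shows "measure_pmf.prob (random_subset E p) {R. F \<subseteq> R} = p ^ card F"
proof -
  have fin: "finite F" using assms finite_subset by blast
  have "{R. F \<subseteq> R} = {R. \<forall>e\<in>F. R \<inter> {e} \<in> {{e}}}" by auto
  hence "measure_pmf.prob (random_subset E p) {R. F \<subseteq> R}
      = (\<Prod>e\<in>F. measure_pmf.prob (random_subset {e} p) {{e}})"
    by (simp only:, intro prob_random_subset_indep) (use assms fin in \<open>auto simp: disjoint_family_on_def\<close>)
  also have "\<dots> = (\<Prod>e\<in>F. p)"
  proof (rule prod.cong)
    fix e :: 'a
    have "((\<lambda>b. if b then {e} else {}) -` {{e}}) = {True}"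
      by (rule set_eqI, case_tac x) simp_all
    hence "measure_pmf.prob (random_subset {e} p) {{e}} = pmf (bernoulli_pmf p) True"
      unfolding random_subset_singleton measure_map_pmf by (simp add: measure_pmf_single)
    thus "measure_pmf.prob (random_subset {e} p) {{e}} = p"
      using p by simp
  qed simp
  finally show ?thesis by simp
qed

lemma prob_random_subset_avoid:
  assumes "finite E" "F \<subseteq> E"
  shows "measure_pmf.prob (random_subset E p) {R. R \<inter> F = {}} = (1 - p) ^ card F"
proof -
  have fin: "finite F" using assms finite_subset by blast
  have "{R. R \<inter> F = {}} = {R. \<forall>e\<in>F. R \<inter> {e} \<in> {{}}}" by auto
  hence "measure_pmf.prob (random_subset E p) {R. R \<inter> F = {}}
      = (\<Prod>e\<in>F. measure_pmf.prob (random_subset {e} p) {{}})"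
    by (simp only:, intro prob_random_subset_indep) (use assms fin in \<open>auto simp: disjoint_family_on_def\<close>)
  also have "\<dots> = (\<Prod>e\<in>F. 1 - p)"
  proof (rule prod.cong)
    fix e :: 'a
    have "((\<lambda>b. if b then {e} else {}) -` {{}}) = {False}"
      by (rule set_eqI, case_tac x) simp_all
    hence "measure_pmf.prob (random_subset {e} p) {{}} = pmf (bernoulli_pmf p) False"
      unfolding random_subset_singleton measure_map_pmf by (simp add: measure_pmf_single)
    thus "measure_pmf.prob (random_subset {e} p) {{}} = 1 - p"
      using p by simp
  qed simp
  finally show ?thesis by simp
qed

lemma prob_random_subset_hit:
  assumes "finite E" "F \<subseteq> E"
  shows "measure_pmf.prob (random_subset E p) {R. R \<inter> F \<noteq> {}} = 1 - (1 - p) ^ card F"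
proof -
  have "{R. R \<inter> F \<noteq> {}} = space (measure_pmf (random_subset E p)) - {R. R \<inter> F = {}}" by auto
  thus ?thesis
    using measure_pmf.prob_compl[of "{R. R \<inter> F = {}}" "random_subset E p"]
      prob_random_subset_avoid[OF assms] by simp
qed

text \<open>
  The moment generating function of the binomial distribution, multiplicatively.
\<close>

lemma expectation_random_subset_power:
  assumes "finite E" "0 \<le> z"
  shows "measure_pmf.expectation (random_subset E p) (\<lambda>R. z ^ card R) = (1 + p * (z - 1)) ^ card E"
proof -
  have "measure_pmf.expectation (random_subset E p) (\<lambda>R. z ^ card R)
    = measure_pmf.expectation (Pi_pmf E False (\<lambda>_. bernoulli_pmf p)) (\<lambda>f. \<Prod>e\<in>E. if f e then z else 1)"
    using assms(1) by (simp add: random_subset_def prod.If_cases Int_def)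
  also have "\<dots> = (\<Prod>e\<in>E. measure_pmf.expectation (bernoulli_pmf p) (\<lambda>b. if b then z else 1))"
    using assms by (intro expectation_prod_Pi_pmf integrable_measure_pmf_finite) auto
  also have "\<dots> = (1 + p * (z - 1)) ^ card E"
    using p by (simp add: algebra_simps)
  finally show ?thesis .
qed

end

lemma pair_pair_pmf_swap:
  "pair_pmf (pair_pmf A B) (pair_pmf C D)
    = map_pmf (\<lambda>((a, c), (b, d)). ((a, b), (c, d))) (pair_pmf (pair_pmf A C) (pair_pmf B D))"
proof (rule pmf_eqI)
  fix x :: "('a \<times> 'b) \<times> ('c \<times> 'd)"
  obtain a b c d where x: "x = ((a, b), (c, d))" by (cases x) auto
  define h :: "('a \<times> 'c) \<times> ('b \<times> 'd) \<Rightarrow> ('a \<times> 'b) \<times> ('c \<times> 'd)"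
    where "h = (\<lambda>((a, c), (b, d)). ((a, b), (c, d)))"
  have "inj h" by (auto simp: inj_def h_def)
  hence "pmf (map_pmf h (pair_pmf (pair_pmf A C) (pair_pmf B D))) (h ((a, c), (b, d)))
      = pmf (pair_pmf (pair_pmf A C) (pair_pmf B D)) ((a, c), (b, d))"
    by (rule pmf_map_inj')
  moreover have "h ((a, c), (b, d)) = x" by (simp add: h_def x)
  ultimately show "pmf (pair_pmf (pair_pmf A B) (pair_pmf C D)) x
      = pmf (map_pmf (\<lambda>((a, c), (b, d)). ((a, b), (c, d))) (pair_pmf (pair_pmf A C) (pair_pmf B D))) x"
    unfolding h_def[symmetric] by (simp add: x pmf_pair)
qed

text \<open>
  Splitting the potential edges of both hypergraphs into those decided first and those decided later.
\<close>

lemma pair_random_subset_Un: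
  assumes "finite E" "finite F" "E \<inter> F = {}"
  shows "pair_pmf (random_subset (E \<union> F) p) (random_subset (E \<union> F) q)
    = map_pmf (\<lambda>((X, Y), (X', Y')). (X \<union> X', Y \<union> Y'))
        (pair_pmf (pair_pmf (random_subset E p) (random_subset E q))
                  (pair_pmf (random_subset F p) (random_subset F q)))"
proof -
  have "pair_pmf (random_subset (E \<union> F) p) (random_subset (E \<union> F) q)
    = map_pmf (\<lambda>((X, X'), (Y, Y')). (X \<union> X', Y \<union> Y'))
        (pair_pmf (pair_pmf (random_subset E p) (random_subset F p))
                  (pair_pmf (random_subset E q) (random_subset F q)))"
    unfolding random_subset_Un[OF assms] map_pair[symmetric]
    by (intro map_pmf_cong) auto
  also have "\<dots> = map_pmf (\<lambda>((X, Y), (X', Y')). (X \<union> X', Y \<union> Y'))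
        (pair_pmf (pair_pmf (random_subset E p) (random_subset E q))
                  (pair_pmf (random_subset F p) (random_subset F q)))"
    unfolding pair_pair_pmf_swap[of "random_subset E p" "random_subset F p"] pmf.map_comp
    by (intro map_pmf_cong) auto
  finally show ?thesis .
qed

section \<open>Perfect matchings\<close>

lemma ex_subset_card_eq: "k \<le> card A \<Longrightarrow> \<exists>T\<subseteq>A. card T = k"
  by (meson obtain_subset_with_card_n)

text \<open>
  Take a bijection with as few non-adjacent pairs as possible. If \<open>a\<close> and \<open>\<sigma> a\<close> are not adjacent,
  then \<open>a\<close> has \<open>r\<close> neighbours and \<open>\<sigma> a\<close> has \<open>r\<close> neighbours; by the joining hypothesis some
  partner \<open>s\<close> of a neighbour of \<open>a\<close> is adjacent to the partner of some neighbour \<open>y\<close> of \<open>\<sigma> a\<close>.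
  Rotating the partners of \<open>a\<close>, \<open>s\<close>, \<open>y\<close> makes all three pairs adjacent, contradicting minimality.
\<close>

lemma perfect_matching_if_expanding:
  fixes A :: "'a set" and B :: "'b set"
  assumes fin: "finite A" "finite B" and card: "card A = card B"
    and degA: "\<And>a. a \<in> A \<Longrightarrow> r \<le> card {b \<in> B. adj a b}"
    and degB: "\<And>b. b \<in> B \<Longrightarrow> r \<le> card {a \<in> A. adj a b}"
    and joined: "\<And>S T. S \<subseteq> A \<Longrightarrow> T \<subseteq> B \<Longrightarrow> card S = r \<Longrightarrow> card T = r \<Longrightarrow> \<exists>a\<in>S. \<exists>b\<in>T. adj a b"
  shows "\<exists>\<sigma>. bij_betw \<sigma> A B \<and> (\<forall>a\<in>A. adj a (\<sigma> a))"
proof -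
  define bad where "bad \<sigma> = {a \<in> A. \<not> adj a (\<sigma> a)}" for \<sigma>
  obtain \<sigma>\<^sub>0 where "bij_betw \<sigma>\<^sub>0 A B" using finite_same_card_bij[OF fin card] by blast
  then obtain \<sigma> where \<sigma>: "bij_betw \<sigma> A B"
    and least: "\<And>\<sigma>'. bij_betw \<sigma>' A B \<Longrightarrow> card (bad \<sigma>) \<le> card (bad \<sigma>')"
    using ex_has_least_nat[of "\<lambda>\<sigma>. bij_betw \<sigma> A B" \<sigma>\<^sub>0 "\<lambda>\<sigma>. card (bad \<sigma>)"] by blast
  have "bad \<sigma> = {}"
  proof (rule ccontr)
    assume "bad \<sigma> \<noteq> {}"
    then obtain a where a: "a \<in> A" "\<not> adj a (\<sigma> a)" by (auto simp: bad_def)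
    have inj: "inj_on \<sigma> A" and img: "\<sigma> ` A = B" using \<sigma> by (auto simp: bij_betw_def)
    have aB: "\<sigma> a \<in> B" using a img by auto
    obtain X where X: "X \<subseteq> {b \<in> B. adj a b}" "card X = r"
      using ex_subset_card_eq[OF degA[OF a(1)]] by blast
    obtain Y where Y: "Y \<subseteq> {y \<in> A. adj y (\<sigma> a)}" "card Y = r"
      using ex_subset_card_eq[OF degB[OF aB]] by blast
    define S where "S = {s \<in> A. \<sigma> s \<in> X}"
    have "\<sigma> ` S = X" using X(1) img by (auto simp: S_def)
    moreover have "inj_on \<sigma> S" using inj by (rule inj_on_subset) (auto simp: S_def)
    ultimately have S: "card S = r" using X(2) card_image by metis
    have T: "card (\<sigma> ` Y) = r"
      using card_image[OF inj_on_subset[OF inj, of Y]] Y by auto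
    have "\<exists>s\<in>S. \<exists>t\<in>\<sigma> ` Y. adj s t"
      using S T Y(1) img by (intro joined) (auto simp: S_def)
    then obtain s y where s: "s \<in> A" "\<sigma> s \<in> X" and y: "y \<in> Y" and adj: "adj s (\<sigma> y)"
      by (auto simp: S_def)
    have yA: "y \<in> A" using y Y by auto
    have ne: "s \<noteq> a" "y \<noteq> a" using s X(1) y Y(1) a(2) by auto
    \<comment> \<open>the rotation \<open>a \<mapsto> s \<mapsto> y \<mapsto> a\<close>, a transposition if \<open>s = y\<close>\<close>
    define \<pi> where "\<pi> = Transposition.transpose a s \<circ> Transposition.transpose s y"
    have \<pi>: "bij_betw \<pi> A A"
      unfolding \<pi>_def using a(1) s(1) yA
      by (intro permutes_imp_bij permutes_compose permutes_swap_id)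
    have "bij_betw (\<sigma> \<circ> \<pi>) A B" using bij_betw_trans[OF \<pi> \<sigma>] .
    moreover have "bad (\<sigma> \<circ> \<pi>) \<subset> bad \<sigma>"
    proof -
      have "adj a (\<sigma> (\<pi> a))" "adj s (\<sigma> (\<pi> s))" "adj y (\<sigma> (\<pi> y))"
        using ne s(2) X(1) y Y(1) adj
        by (auto simp: \<pi>_def Transposition.transpose_def)
      moreover have "\<pi> c = c" if "c \<notin> {a, s, y}" for c
        using that by (auto simp: \<pi>_def Transposition.transpose_def)
      ultimately have "bad (\<sigma> \<circ> \<pi>) \<subseteq> bad \<sigma> - {a}"
        unfolding bad_def by (intro subsetI, case_tac "x \<in> {a, s, y}") auto
      moreover have "a \<in> bad \<sigma>" using a by (auto simp: bad_def)
      ultimately show ?thesis by blast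
    qed
    hence "card (bad (\<sigma> \<circ> \<pi>)) < card (bad \<sigma>)"
      using fin by (intro psubset_card_mono) (auto simp: bad_def)
    ultimately show False using least[of "\<sigma> \<circ> \<pi>"] by simp
  qed
  thus ?thesis using \<sigma> by (auto simp: bad_def)
qed

section \<open>Compatibility of random links\<close>

text \<open>
  Disjoint sets are hit independently, each with probability at most \<open>1 - \<theta>\<close>; the factor
  \<open>card S ^ v\<close> counts the choices of the \<open>v\<close> sets that need not be hit.
\<close>

lemma prob_hit_almost_all_le:
  fixes p \<theta> :: real
  assumes p: "0 \<le> p" "p \<le> 1" and fin: "finite V" "finite S"
    and E: "\<And>i. i \<in> S \<Longrightarrow> E i \<subseteq> V" "disjoint_family_on E S"
    and \<theta>: "\<theta> \<le> 1" "\<And>i. i \<in> S \<Longrightarrow> \<theta> \<le> (1 - p) ^ card (E i)"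
    and v: "v \<le> card S"
  shows "measure_pmf.prob (random_subset V p) {R. card S \<le> card {i \<in> S. R \<inter> E i \<noteq> {}} + v}
    \<le> card S ^ v * (1 - \<theta>) ^ (card S - v)"
proof -
  let ?I = "{T. T \<subseteq> S \<and> card T = card S - v}"
  have finI: "finite ?I" using fin by simp
  have "measure_pmf.prob (random_subset V p) {R. card S \<le> card {i \<in> S. R \<inter> E i \<noteq> {}} + v}
      \<le> card ?I * (1 - \<theta>) ^ (card S - v)"
  proof (rule prob_union_bound_card[OF finI, where Q = "\<lambda>T. {R. \<forall>i\<in>T. R \<inter> E i \<in> {X. X \<inter> E i \<noteq> {}}}"])
    fix R assume "R \<in> {R. card S \<le> card {i \<in> S. R \<inter> E i \<noteq> {}} + v}"
    hence "card S - v \<le> card {i \<in> S. R \<inter> E i \<noteq> {}}" by simp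
    from ex_subset_card_eq[OF this] obtain T where "T \<subseteq> {i \<in> S. R \<inter> E i \<noteq> {}}" "card T = card S - v"
      by blast
    thus "\<exists>T\<in>?I. R \<in> {R. \<forall>i\<in>T. R \<inter> E i \<in> {X. X \<inter> E i \<noteq> {}}}"
      by (intro bexI[of _ T]) auto
  next
    fix T assume T: "T \<in> ?I"
    have finE: "finite (E i)" if "i \<in> T" for i using E(1) fin(1) T that finite_subset by blast
    have "measure_pmf.prob (random_subset V p) {R. \<forall>i\<in>T. R \<inter> E i \<in> {X. X \<inter> E i \<noteq> {}}}
        = (\<Prod>i\<in>T. measure_pmf.prob (random_subset (E i) p) {X. X \<inter> E i \<noteq> {}})"
      using T fin E(1) finE
      by (intro prob_random_subset_indep disjoint_family_on_mono[OF _ E(2)]) (auto intro: finite_subset)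
    also have "\<dots> \<le> (\<Prod>i\<in>T. 1 - \<theta>)"
    proof (intro prod_mono conjI)
      fix i assume i: "i \<in> T"
      have "measure_pmf.prob (random_subset (E i) p) {X. X \<inter> E i \<noteq> {}} = 1 - (1 - p) ^ card (E i)"
        using prob_random_subset_hit[OF p finE[OF i] subset_refl] .
      also have "\<dots> \<le> 1 - \<theta>" using \<theta>(2) i T by auto
      finally show "measure_pmf.prob (random_subset (E i) p) {X. X \<inter> E i \<noteq> {}} \<le> 1 - \<theta>" .
    qed simp
    also have "\<dots> = (1 - \<theta>) ^ (card S - v)" using T by simp
    finally show "measure_pmf.prob (random_subset V p) {R. \<forall>i\<in>T. R \<inter> E i \<in> {X. X \<inter> E i \<noteq> {}}}
        \<le> (1 - \<theta>) ^ (card S - v)" .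
  qed
  also have "card ?I = card S choose v"
    using n_subsets[OF fin(2), of "card S - v"] binomial_symmetric[OF v] by simp
  also have "real (card S choose v) * (1 - \<theta>) ^ (card S - v) \<le> card S ^ v * (1 - \<theta>) ^ (card S - v)"
    using binomial_le_pow[OF v] \<theta>(1) by (intro mult_right_mono) (simp_all only: of_nat_le_iff zero_le_power diff_ge_0_iff_ge)
  finally show ?thesis .
qed

text \<open>
  Relations are used to describe families of links: \<open>R `` {b}\<close> is the link of \<open>b\<close>. The links of
  different vertices are independent random subsets of \<open>F\<close>.
\<close>

lemma prob_random_relation_columns:
  assumes "finite B" "finite F" "T \<subseteq> B"
  shows "measure_pmf.prob (random_subset (B \<times> F) p) {R. \<forall>b\<in>T. R `` {b} \<inter> F \<in> Q}
    = measure_pmf.prob (random_subset F p) Q ^ card T"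
proof -
  have finT: "finite T" using assms finite_subset by blast
  have img: "R `` {b} \<inter> F = snd ` (R \<inter> {b} \<times> F)" for R b by force
  have "{R. \<forall>b\<in>T. R `` {b} \<inter> F \<in> Q} = {R. \<forall>b\<in>T. R \<inter> {b} \<times> F \<in> {X. snd ` X \<in> Q}}"
    by (simp only: img mem_Collect_eq)
  hence "measure_pmf.prob (random_subset (B \<times> F) p) {R. \<forall>b\<in>T. R `` {b} \<inter> F \<in> Q}
      = (\<Prod>b\<in>T. measure_pmf.prob (random_subset ({b} \<times> F) p) {X. snd ` X \<in> Q})"
    using assms finT
    by (simp only:, intro prob_random_subset_indep) (auto simp: disjoint_family_on_def)
  also have "\<dots> = (\<Prod>b\<in>T. measure_pmf.prob (random_subset F p) Q)"
  proof (rule prod.cong)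
    fix b
    have "{b} \<times> F = Pair b ` F" by auto
    thus "measure_pmf.prob (random_subset ({b} \<times> F) p) {X. snd ` X \<in> Q}
        = measure_pmf.prob (random_subset F p) Q"
      using prob_random_subset_image[OF assms(2), of "Pair b" p "{X. snd ` X \<in> Q}"]
      by (simp add: inj_on_def image_image)
  qed simp
  finally show ?thesis by simp
qed

definition overlap :: "'a set \<Rightarrow> ('a \<times> 'f) set \<Rightarrow> 'f set" where
  "overlap A D = {f. 2 \<le> card {a \<in> A. (a, f) \<in> D}}"

text \<open>
  The properties of the family of links \<open>D `` {a}\<close> in the sparser hypergraph that are needed: each
  link is so small that a random set of density \<open>q\<close> misses it with probability at least \<open>\<theta>\<close>, no
  element lies in more than \<open>c\<close> links, and \<open>y\<close> bounds the probability that a random set of density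
  \<open>q\<close> contains \<open>j\<close> elements of the overlap. The last item is phrased through the expected number
  of \<open>j\<close>-subsets of the overlap that the random set contains, because the expectation of this
  quantity over \<open>D\<close> is easy to compute.
\<close>

definition scattered ::
    "'a set \<Rightarrow> 'f set \<Rightarrow> real \<Rightarrow> real \<Rightarrow> nat \<Rightarrow> nat \<Rightarrow> real \<Rightarrow> ('a \<times> 'f) set \<Rightarrow> bool" where
  "scattered A F q \<theta> c j y D \<longleftrightarrow> D \<subseteq> A \<times> F \<and>
     (\<forall>a\<in>A. \<theta> \<le> (1 - q) ^ card (D `` {a})) \<and>
     (\<forall>f\<in>F. card {a \<in> A. (a, f) \<in> D} \<le> c) \<and>
     real (card (overlap A D) choose j) * q ^ j \<le> y"

text \<open>
  Away from the overlap the links are disjoint, so \<open>prob_hit_almost_all_le\<close> applies to the reduced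
  links. Unless \<open>L\<close> contains \<open>j\<close> elements of the overlap, which has probability at most \<open>y\<close>, at most
  \<open>c * j\<close> links are met by \<open>L\<close> inside the overlap; they are added to the allowance \<open>u\<close>.
\<close>

lemma prob_hit_scattered_le:
  fixes q \<theta> y :: real
  assumes q: "0 \<le> q" "q \<le> 1" and fin: "finite A" "finite F"
    and D: "scattered A F q \<theta> c j y D" and \<theta>: "0 \<le> \<theta>" "\<theta> \<le> 1"
    and S: "S \<subseteq> A" "u + c * j \<le> card S"
  shows "measure_pmf.prob (random_subset F q) {L. card S \<le> card {a \<in> S. L \<inter> D `` {a} \<noteq> {}} + u}
    \<le> y + card S ^ (u + c * j) * (1 - \<theta>) ^ (card S - (u + c * j))"
proof -
  define Ov where "Ov = overlap A D"
  define E where "E a = D `` {a} - Ov" for a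
  have finS: "finite S" using S fin finite_subset by blast
  have DF: "D \<subseteq> A \<times> F" and deg: "\<And>a. a \<in> A \<Longrightarrow> \<theta> \<le> (1 - q) ^ card (D `` {a})"
    and mult: "\<And>f. f \<in> F \<Longrightarrow> card {a \<in> A. (a, f) \<in> D} \<le> c"
    and y: "real (card Ov choose j) * q ^ j \<le> y"
    using D unfolding scattered_def Ov_def by auto
  have OvF: "Ov \<subseteq> F"
  proof
    fix f assume "f \<in> Ov"
    hence "{a \<in> A. (a, f) \<in> D} \<noteq> {}" unfolding Ov_def overlap_def by force
    thus "f \<in> F" using DF by auto
  qed
  have finOv: "finite Ov" using OvF fin finite_subset by blast
  have EF: "E a \<subseteq> F" for a using DF by (auto simp: E_def)
  have finD: "finite (D `` {a})" for a by (rule finite_subset[OF _ fin(2)]) (use DF in auto)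
  have disj: "disjoint_family_on E S"
    unfolding disjoint_family_on_def
  proof (intro ballI impI, rule ccontr)
    fix a b assume ab: "a \<in> S" "b \<in> S" "a \<noteq> b" "E a \<inter> E b \<noteq> {}"
    then obtain f where f: "(a, f) \<in> D" "(b, f) \<in> D" "f \<notin> Ov" by (auto simp: E_def)
    have "card {a, b} \<le> card {a \<in> A. (a, f) \<in> D}"
      using fin ab f S by (intro card_mono) auto
    thus False using f(3) ab(3) by (simp add: Ov_def overlap_def)
  qed
  have Q: "measure_pmf.prob (random_subset F q) {L. j \<le> card (L \<inter> Ov)} \<le> y"
  proof -
    let ?I = "{J. J \<subseteq> Ov \<and> card J = j}"
    have "measure_pmf.prob (random_subset F q) {L. j \<le> card (L \<inter> Ov)} \<le> card ?I * q ^ j"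
    proof (rule prob_union_bound_card[where Q = "\<lambda>J. {L. J \<subseteq> L}"])
      fix L assume "L \<in> {L. j \<le> card (L \<inter> Ov)}"
      then obtain J where "J \<subseteq> L \<inter> Ov" "card J = j"
        using ex_subset_card_eq[of j "L \<inter> Ov"] by auto
      thus "\<exists>J\<in>?I. L \<in> {L. J \<subseteq> L}" by blast
    next
      fix J assume "J \<in> ?I"
      thus "measure_pmf.prob (random_subset F q) {L. J \<subseteq> L} \<le> q ^ j"
        using prob_random_subset_superset[OF q fin(2), of J] OvF by auto
    qed (use finOv in simp)
    also have "card ?I = card Ov choose j" by (rule n_subsets[OF finOv])
    finally show ?thesis using y by linarith
  qed
  have R: "measure_pmf.prob (random_subset F q)
      {L. card S \<le> card {a \<in> S. L \<inter> E a \<noteq> {}} + (u + c * j)}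
    \<le> card S ^ (u + c * j) * (1 - \<theta>) ^ (card S - (u + c * j))"
  proof (rule prob_hit_almost_all_le[OF q fin(2) finS EF disj \<theta>(2) _ S(2)])
    fix a assume "a \<in> S"
    hence "\<theta> \<le> (1 - q) ^ card (D `` {a})" using deg S by auto
    also have "\<dots> \<le> (1 - q) ^ card (E a)"
      using q finD by (intro power_decreasing card_mono) (auto simp: E_def)
    finally show "\<theta> \<le> (1 - q) ^ card (E a)" .
  qed
  show ?thesis
  proof (rule prob_le_Un[OF _ Q R])
    fix L assume L: "L \<in> set_pmf (random_subset F q)"
      and many: "L \<in> {L. card S \<le> card {a \<in> S. L \<inter> D `` {a} \<noteq> {}} + u}"
    show "L \<in> {L. j \<le> card (L \<inter> Ov)} \<or> L \<in> {L. card S \<le> card {a \<in> S. L \<inter> E a \<noteq> {}} + (u + c * j)}"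
    proof (cases "j \<le> card (L \<inter> Ov)")
      case False
      \<comment> \<open>the vertices whose links are met by \<open>L\<close> inside the overlap\<close>
      let ?H = "\<Union>f\<in>L \<inter> Ov. {a \<in> A. (a, f) \<in> D}"
      have "card ?H \<le> (\<Sum>f\<in>L \<inter> Ov. card {a \<in> A. (a, f) \<in> D})"
        using finOv by (intro card_UN_le) auto
      also have "\<dots> \<le> (\<Sum>f\<in>L \<inter> Ov. c)"
        using OvF by (intro sum_mono mult) auto
      also have "\<dots> \<le> c * j" using False by simp
      finally have H: "card ?H \<le> c * j" .
      have "{a \<in> S. L \<inter> D `` {a} \<noteq> {}} \<subseteq> {a \<in> S. L \<inter> E a \<noteq> {}} \<union> ?H"
        using S(1) by (auto simp: E_def)
      hence "card {a \<in> S. L \<inter> D `` {a} \<noteq> {}} \<le> card ({a \<in> S. L \<inter> E a \<noteq> {}} \<union> ?H)"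
        using finS fin finOv by (intro card_mono) auto
      also have "\<dots> \<le> card {a \<in> S. L \<inter> E a \<noteq> {}} + card ?H" by (rule card_Un_le)
      finally show ?thesis using H many by simp
    qed simp
  qed
qed

text \<open>
  The three summands correspond to the hypotheses of \<open>perfect_matching_if_expanding\<close>. The degree of
  \<open>a \<in> A'\<close> is governed by the independent links of the vertices of \<open>B'\<close>, that of \<open>b \<in> B'\<close> by
  \<open>prob_hit_scattered_le\<close>. If \<open>S\<close> and \<open>T\<close> are not joined, then each of the \<open>r\<close> independent links
  of vertices of \<open>T\<close> meets all links of vertices of \<open>S\<close>; the power \<open>r\<close> thus gained beats the
  number \<open>m ^ (2 * r)\<close> of pairs \<open>(S, T)\<close>.
\<close>

lemma prob_no_matching_le:
  fixes q \<theta> y :: real and A :: "'a set" and F :: "'f set" and B :: "'b set"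
  assumes q: "0 \<le> q" "q \<le> 1" and fin: "finite A" "finite F" "finite B"
    and D: "scattered A F q \<theta> c j y D" and \<theta>: "0 \<le> \<theta>" "\<theta> \<le> 1" and y0: "0 \<le> y"
    and A': "A' \<subseteq> A" "card A' = m" and B': "B' \<subseteq> B" "card B' = m"
    and r: "c * j \<le> r" "r + c * j \<le> m"
  shows "measure_pmf.prob (random_subset (B \<times> F) q)
      {R. \<not> (\<exists>\<sigma>. bij_betw \<sigma> A' B' \<and> (\<forall>a\<in>A'. R `` {\<sigma> a} \<inter> D `` {a} = {}))}
    \<le> m * (m ^ r * (1 - \<theta>) ^ (m - r)) + m * (y + m ^ (r + c * j) * (1 - \<theta>) ^ (m - (r + c * j)))
      + m ^ (2 * r) * (y + r ^ (c * j) * (1 - \<theta>) ^ (r - c * j)) ^ r"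
proof -
  let ?M = "random_subset (B \<times> F) q"
  define hit where "hit S u = {L. card S \<le> card {a \<in> S. L \<inter> D `` {a} \<noteq> {}} + u}" for S u
  have finA': "finite A'" and finB': "finite B'" using A' B' fin finite_subset by blast+
  have DF: "D `` {a} \<subseteq> F" for a using D unfolding scattered_def by auto
  have FD: "R `` {b} \<inter> F \<inter> D `` {a} = R `` {b} \<inter> D `` {a}" for R :: "('b \<times> 'f) set" and a b using DF by auto
  define Q1 where "Q1 = {R :: ('b \<times> 'f) set. \<exists>a\<in>A'. card B' \<le> card {b \<in> B'. R \<inter> {b} \<times> D `` {a} \<noteq> {}} + r}"
  define Q2 where "Q2 = {R :: ('b \<times> 'f) set. \<exists>b\<in>B'. \<forall>b'\<in>{b}. R `` {b'} \<inter> F \<in> hit A' r}"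
  \<comment> \<open>\<open>hit S u\<close> with \<open>u = 0\<close> says that all links of vertices of \<open>S\<close> are met\<close>
  define Q3 where "Q3 = {R :: ('b \<times> 'f) set. \<exists>S T. S \<subseteq> A' \<and> T \<subseteq> B' \<and> card S = r \<and> card T = r \<and> (\<forall>b\<in>T. R `` {b} \<inter> F \<in> hit S 0)}"
  have "measure_pmf.prob ?M Q1 \<le> card A' * (m ^ r * (1 - \<theta>) ^ (m - r))"
  proof (rule prob_union_bound_card[OF finA'])
    fix a assume "a \<in> A'"
    hence a: "a \<in> A" using A' by auto
    show "measure_pmf.prob ?M {R. card B' \<le> card {b \<in> B'. R \<inter> {b} \<times> D `` {a} \<noteq> {}} + r}
        \<le> m ^ r * (1 - \<theta>) ^ (m - r)"
      unfolding B'(2)[symmetric]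
    proof (rule prob_hit_almost_all_le[OF q _ finB'])
      show "\<theta> \<le> (1 - q) ^ card ({b} \<times> D `` {a})" for b
        using D a by (simp add: scattered_def card_cartesian_product_singleton)
    qed (use fin B' DF r \<theta> in \<open>auto simp: disjoint_family_on_def\<close>)
  qed (auto simp: Q1_def)
  hence 1: "measure_pmf.prob ?M Q1 \<le> m * (m ^ r * (1 - \<theta>) ^ (m - r))" using A' by simp
  have "measure_pmf.prob ?M Q2 \<le> card B' * (y + m ^ (r + c * j) * (1 - \<theta>) ^ (m - (r + c * j)))"
  proof (rule prob_union_bound_card[OF finB', where Q = "\<lambda>b. {R. \<forall>b'\<in>{b}. R `` {b'} \<inter> F \<in> hit A' r}"])
    fix b assume "b \<in> B'"
    hence "measure_pmf.prob ?M {R. \<forall>b'\<in>{b}. R `` {b'} \<inter> F \<in> hit A' r}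
        = measure_pmf.prob (random_subset F q) (hit A' r)"
      using prob_random_relation_columns[OF fin(3,2), of "{b}" q "hit A' r"] B' by auto
    also have "\<dots> \<le> y + m ^ (r + c * j) * (1 - \<theta>) ^ (m - (r + c * j))"
      unfolding hit_def using prob_hit_scattered_le[OF q fin(1,2) D \<theta> A'(1), of r] r A' by simp
    finally show "measure_pmf.prob ?M {R. \<forall>b'\<in>{b}. R `` {b'} \<inter> F \<in> hit A' r}
        \<le> y + m ^ (r + c * j) * (1 - \<theta>) ^ (m - (r + c * j))" .
  qed (auto simp: Q2_def)
  hence 2: "measure_pmf.prob ?M Q2 \<le> m * (y + m ^ (r + c * j) * (1 - \<theta>) ^ (m - (r + c * j)))" using B' by simp
  have 3: "measure_pmf.prob ?M Q3 \<le> m ^ (2 * r) * (y + r ^ (c * j) * (1 - \<theta>) ^ (r - c * j)) ^ r"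
  proof -
    let ?I = "{S. S \<subseteq> A' \<and> card S = r} \<times> {T. T \<subseteq> B' \<and> card T = r}"
    have "measure_pmf.prob ?M Q3 \<le> card ?I * (y + r ^ (c * j) * (1 - \<theta>) ^ (r - c * j)) ^ r"
    proof (rule prob_union_bound_card[where Q = "\<lambda>(S, T). {R. \<forall>b\<in>T. R `` {b} \<inter> F \<in> hit S 0}"])
      fix i assume "i \<in> ?I"
      then obtain S T where i: "i = (S, T)" and S: "S \<subseteq> A'" "card S = r" and T: "T \<subseteq> B'" "card T = r" by auto
      have "measure_pmf.prob ?M {R. \<forall>b\<in>T. R `` {b} \<inter> F \<in> hit S 0}
          = measure_pmf.prob (random_subset F q) (hit S 0) ^ r"
        using prob_random_relation_columns[OF fin(3,2), of T q "hit S 0"] B' T by auto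
      also have "\<dots> \<le> (y + r ^ (c * j) * (1 - \<theta>) ^ (r - c * j)) ^ r"
        unfolding hit_def using prob_hit_scattered_le[OF q fin(1,2) D \<theta>, of S 0] r A' S
        by (intro power_mono) auto
      finally show "measure_pmf.prob ?M (case i of (S, T) \<Rightarrow> {R. \<forall>b\<in>T. R `` {b} \<inter> F \<in> hit S 0})
          \<le> (y + r ^ (c * j) * (1 - \<theta>) ^ (r - c * j)) ^ r" by (simp add: i)
    qed (use finA' finB' in \<open>auto simp: Q3_def\<close>)
    also have "card ?I = (m choose r) * (m choose r)"
      using n_subsets[OF finA', of r] n_subsets[OF finB', of r] A' B' by (simp add: card_cartesian_product)
    also have "real ((m choose r) * (m choose r)) * (y + r ^ (c * j) * (1 - \<theta>) ^ (r - c * j)) ^ r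
        \<le> real (m ^ r * m ^ r) * (y + r ^ (c * j) * (1 - \<theta>) ^ (r - c * j)) ^ r"
      using binomial_le_pow[of r m] r y0 \<theta>
      by (intro mult_right_mono of_nat_mono mult_mono zero_le_power add_nonneg_nonneg mult_nonneg_nonneg) auto
    finally show ?thesis by (simp add: power_add[symmetric] mult_2)
  qed
  have cover: "R \<in> Q1 \<union> Q2 \<or> R \<in> Q3" if R: "R \<in> {R. \<not> (\<exists>\<sigma>. bij_betw \<sigma> A' B' \<and> (\<forall>a\<in>A'. R `` {\<sigma> a} \<inter> D `` {a} = {}))}" for R
  proof -
    show ?thesis
    proof (rule ccontr)
      assume n: "\<not> (R \<in> Q1 \<union> Q2 \<or> R \<in> Q3)"
      let ?adj = "\<lambda>a b. R `` {b} \<inter> D `` {a} = {}"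
      have compl: "card {x \<in> X. P x} + card {x \<in> X. \<not> P x} = card X" if "finite X" for X P
      proof -
        have "card ({x \<in> X. P x} \<union> {x \<in> X. \<not> P x}) = card {x \<in> X. P x} + card {x \<in> X. \<not> P x}"
          using that by (intro card_Un_disjoint) auto
        moreover have "{x \<in> X. P x} \<union> {x \<in> X. \<not> P x} = X" by auto
        ultimately show ?thesis by simp
      qed
      have "\<exists>\<sigma>. bij_betw \<sigma> A' B' \<and> (\<forall>a\<in>A'. ?adj a (\<sigma> a))"
      proof (rule perfect_matching_if_expanding[OF finA' finB', where r = r])
        fix a assume a: "a \<in> A'"
        have "{b \<in> B'. R \<inter> {b} \<times> D `` {a} \<noteq> {}} = {b \<in> B'. \<not> ?adj a b}" by auto
        with n a have "\<not> card B' \<le> card {b \<in> B'. \<not> ?adj a b} + r" by (auto simp: Q1_def)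
        thus "r \<le> card {b \<in> B'. ?adj a b}" using compl[OF finB', of "?adj a"] by simp
      next
        fix b assume b: "b \<in> B'"
        with n have "\<not> card A' \<le> card {a \<in> A'. \<not> ?adj a b} + r" by (auto simp: Q2_def hit_def FD)
        thus "r \<le> card {a \<in> A'. ?adj a b}" using compl[OF finA', of "\<lambda>a. ?adj a b"] by simp
      next
        fix S T assume ST: "S \<subseteq> A'" "T \<subseteq> B'" "card S = r" "card T = r"
        have finS: "finite S" using ST finA' finite_subset by blast
        have "\<not> (\<forall>b\<in>T. R `` {b} \<inter> F \<in> hit S 0)" using n ST unfolding Q3_def by blast
        then obtain b where b: "b \<in> T" "R `` {b} \<inter> F \<notin> hit S 0" by blast
        have "\<exists>a\<in>S. ?adj a b"
        proof (rule ccontr)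
          assume "\<not> ?thesis"
          hence "{a \<in> S. R `` {b} \<inter> F \<inter> D `` {a} \<noteq> {}} = S" by (auto simp: FD)
          thus False using b(2) by (simp add: hit_def)
        qed
        thus "\<exists>a\<in>S. \<exists>b\<in>T. ?adj a b" using b by blast
      qed (use A' B' in simp)
      with R show False by blast
    qed
  qed
  have 12: "measure_pmf.prob ?M (Q1 \<union> Q2)
      \<le> m * (m ^ r * (1 - \<theta>) ^ (m - r)) + m * (y + m ^ (r + c * j) * (1 - \<theta>) ^ (m - (r + c * j)))"
    by (rule prob_le_Un[OF _ 1 2]) blast
  have "measure_pmf.prob ?M {R. \<not> (\<exists>\<sigma>. bij_betw \<sigma> A' B' \<and> (\<forall>a\<in>A'. R `` {\<sigma> a} \<inter> D `` {a} = {}))}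
      \<le> (m * (m ^ r * (1 - \<theta>) ^ (m - r)) + m * (y + m ^ (r + c * j) * (1 - \<theta>) ^ (m - (r + c * j))))
        + m ^ (2 * r) * (y + r ^ (c * j) * (1 - \<theta>) ^ (r - c * j)) ^ r"
    by (rule prob_le_Un[OF cover 12 3])
  thus ?thesis by simp
qed

lemma binomial_le_power: "n choose k \<le> n ^ k"
  by (cases "k \<le> n") (auto simp: binomial_le_pow binomial_eq_0)

text \<open>
  The three summands are a Chernoff bound for the sizes of the links, a union bound for the
  multiplicities, and Markov's inequality for the number of \<open>j\<close>-subsets of the overlap. The
  parameter \<open>s\<close> is the exponent in the Chernoff bound and can be chosen freely.
\<close>

lemma prob_not_scattered_le:
  fixes p q \<theta> y :: real and A :: "'a set" and F :: "'f set"
  assumes p: "0 \<le> p" "p \<le> 1" and q: "0 \<le> q" "q < 1" and fin: "finite A" "finite F"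
    and \<theta>: "0 < \<theta>" and y: "0 < y"
  shows "measure_pmf.prob (random_subset (A \<times> F) p) {D. \<not> scattered A F q \<theta> c j y D}
    \<le> card A * (\<theta> ^ s * (1 + p * (1 / (1 - q) ^ s - 1)) ^ card F)
      + card F * (card A * p) ^ Suc c + (card F * ((card A * p)\<^sup>2 * q)) ^ j / y"
proof -
  let ?M = "random_subset (A \<times> F) p"
  have finAF: "finite (A \<times> F)" using fin by simp
  define Q1 where "Q1 = {D :: ('a \<times> 'f) set. \<exists>a\<in>A. (1 - q) ^ card (D `` {a} \<inter> F) < \<theta>}"
  define Q2 where "Q2 = {D :: ('a \<times> 'f) set. \<exists>f\<in>F. Suc c \<le> card {a \<in> A. (a, f) \<in> D}}"
  define Q3 where "Q3 = {D :: ('a \<times> 'f) set. y \<le> real (card (overlap A D) choose j) * q ^ j}"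
  have 1: "measure_pmf.prob ?M Q1 \<le> card A * (\<theta> ^ s * (1 + p * (1 / (1 - q) ^ s - 1)) ^ card F)"
  proof (rule prob_union_bound_card[OF fin(1), where Q = "\<lambda>a. {D. \<forall>a'\<in>{a}. D `` {a'} \<inter> F \<in> {X. (1 - q) ^ card X < \<theta>}}"])
    fix a assume a: "a \<in> A"
    define z where "z = 1 / (1 - q) ^ s"
    have z: "0 \<le> z" using q by (simp add: z_def)
    have "measure_pmf.prob ?M {D. \<forall>a'\<in>{a}. D `` {a'} \<inter> F \<in> {X. (1 - q) ^ card X < \<theta>}}
        = measure_pmf.prob (random_subset F p) {X. (1 - q) ^ card X < \<theta>}"
      using prob_random_relation_columns[OF fin, of "{a}" p "{X. (1 - q) ^ card X < \<theta>}"] a by auto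
    also have "\<dots> \<le> measure_pmf.prob (random_subset F p) {X. 1 / \<theta> ^ s \<le> z ^ card X}"
    proof (rule prob_le_if, safe)
      fix X assume "(1 - q) ^ card X < \<theta>"
      hence "((1 - q) ^ card X) ^ s \<le> \<theta> ^ s" using q by (intro power_mono) auto
      moreover have "z ^ card X = 1 / ((1 - q) ^ card X) ^ s"
        by (simp add: z_def power_one_over power_mult[symmetric] mult.commute)
      moreover have "0 < ((1 - q) ^ card X) ^ s" using q by simp
      ultimately show "1 / \<theta> ^ s \<le> z ^ card X" by (simp add: frac_le)
    qed
    also have "\<dots> \<le> measure_pmf.expectation (random_subset F p) (\<lambda>X. z ^ card X) / (1 / \<theta> ^ s)"
      using fin z \<theta> by (intro prob_markov finite_set_pmf_random_subset) auto
    also have "\<dots> = \<theta> ^ s * (1 + p * (1 / (1 - q) ^ s - 1)) ^ card F"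
      using expectation_random_subset_power[OF p fin(2) z] by (simp add: z_def)
    finally show "measure_pmf.prob ?M {D. \<forall>a'\<in>{a}. D `` {a'} \<inter> F \<in> {X. (1 - q) ^ card X < \<theta>}}
        \<le> \<theta> ^ s * (1 + p * (1 / (1 - q) ^ s - 1)) ^ card F" .
  qed (auto simp: Q1_def)
  \<comment> \<open>used with \<open>l = Suc c\<close> for the multiplicities and with \<open>l = 2\<close> for the overlap\<close>
  have few: "measure_pmf.prob (random_subset V p) {X. l \<le> card {a \<in> A. (a, f) \<in> X}} \<le> (card A * p) ^ l"
    if V: "finite V" "A \<times> {f} \<subseteq> V" for l f V
  proof -
    let ?I = "{S. S \<subseteq> A \<and> card S = l}"
    have "measure_pmf.prob (random_subset V p) {X. l \<le> card {a \<in> A. (a, f) \<in> X}} \<le> card ?I * p ^ l"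
    proof (rule prob_union_bound_card[where Q = "\<lambda>S. {X. S \<times> {f} \<subseteq> X}"])
      fix X assume "X \<in> {X. l \<le> card {a \<in> A. (a, f) \<in> X}}"
      then obtain S where "S \<subseteq> {a \<in> A. (a, f) \<in> X}" "card S = l"
        using ex_subset_card_eq[of l "{a \<in> A. (a, f) \<in> X}"] by auto
      thus "\<exists>S\<in>?I. X \<in> {X. S \<times> {f} \<subseteq> X}" by (intro bexI[of _ S]) auto
    next
      fix S assume S: "S \<in> ?I"
      have "measure_pmf.prob (random_subset V p) {X. S \<times> {f} \<subseteq> X} = p ^ card (S \<times> {f})"
        using S V by (intro prob_random_subset_superset p) auto
      thus "measure_pmf.prob (random_subset V p) {X. S \<times> {f} \<subseteq> X} \<le> p ^ l"
        using S by (simp add: card_cartesian_product)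
    qed (use fin in simp)
    also have "card ?I = card A choose l" by (rule n_subsets[OF fin(1)])
    also have "real (card A choose l) * p ^ l \<le> real (card A ^ l) * p ^ l"
      using p by (intro mult_right_mono of_nat_mono binomial_le_power) simp
    finally show ?thesis by (simp add: power_mult_distrib)
  qed
  have 2: "measure_pmf.prob ?M Q2 \<le> card F * (card A * p) ^ Suc c"
    by (rule prob_union_bound_card[OF fin(2), where Q = "\<lambda>f. {D. Suc c \<le> card {a \<in> A. (a, f) \<in> D}}"])
       (use finAF in \<open>auto simp: Q2_def simp del: power_Suc intro!: few\<close>)
  have 3: "measure_pmf.prob ?M Q3 \<le> (card F * ((card A * p)\<^sup>2 * q)) ^ j / y"
  proof -
    let ?I = "{J. J \<subseteq> F \<and> card J = j}"
    have finI: "finite ?I" using fin by simp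
    have J: "measure_pmf.prob ?M {D. J \<subseteq> overlap A D} \<le> ((card A * p)\<^sup>2) ^ j" if J: "J \<in> ?I" for J
    proof -
      have "{D. J \<subseteq> overlap A D} = {D. \<forall>f\<in>J. D \<inter> A \<times> {f} \<in> {X. 2 \<le> card {a \<in> A. (a, f) \<in> X}}}"
        by (auto simp: overlap_def conj_ac)
      hence "measure_pmf.prob ?M {D. J \<subseteq> overlap A D}
          = (\<Prod>f\<in>J. measure_pmf.prob (random_subset (A \<times> {f}) p) {X. 2 \<le> card {a \<in> A. (a, f) \<in> X}})"
        using J fin finAF by (simp only:, intro prob_random_subset_indep)
          (auto simp: disjoint_family_on_def intro: finite_subset)
      also have "\<dots> \<le> (\<Prod>f\<in>J. (card A * p)\<^sup>2)"
        using fin by (intro prod_mono conjI few) auto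
      finally show ?thesis using J by simp
    qed
    have "measure_pmf.prob ?M Q3 \<le> measure_pmf.expectation ?M (\<lambda>D. real (card (overlap A D) choose j) * q ^ j) / y"
      unfolding Q3_def using y q finAF by (intro prob_markov finite_set_pmf_random_subset) auto
    also have "measure_pmf.expectation ?M (\<lambda>D. real (card (overlap A D) choose j) * q ^ j)
        = measure_pmf.expectation ?M (\<lambda>D. (\<Sum>J\<in>?I. indicator {D. J \<subseteq> overlap A D} D) * q ^ j)"
    proof (rule Bochner_Integration.integral_cong_AE, simp, simp, unfold AE_measure_pmf_iff, intro ballI)
      fix D assume "D \<in> set_pmf ?M"
      hence D: "D \<subseteq> A \<times> F" by (rule set_pmf_random_subset)
      have sub: "overlap A D \<subseteq> F"
      proof
        fix f assume "f \<in> overlap A D"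
        hence "{a \<in> A. (a, f) \<in> D} \<noteq> {}" unfolding overlap_def by force
        thus "f \<in> F" using D by auto
      qed
      have "card (overlap A D) choose j = card {J. J \<subseteq> overlap A D \<and> card J = j}"
        using n_subsets[of "overlap A D" j] finite_subset[OF sub fin(2)] by simp
      also have "{J. J \<subseteq> overlap A D \<and> card J = j} = {J \<in> ?I. J \<subseteq> overlap A D}" using sub by auto
      also have "real (card {J \<in> ?I. J \<subseteq> overlap A D}) = (\<Sum>J\<in>?I. indicator {D. J \<subseteq> overlap A D} D)"
        using finI by (simp add: indicator_def sum.If_cases Int_def)
      finally show "real (card (overlap A D) choose j) * q ^ j
          = (\<Sum>J\<in>?I. indicat_real {D. J \<subseteq> overlap A D} D) * q ^ j" by simp
    qed
    also have "\<dots> = (\<Sum>J\<in>?I. measure_pmf.prob ?M {D. J \<subseteq> overlap A D}) * q ^ j"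
      using finAF by (subst integral_mult_left_zero, subst Bochner_Integration.integral_sum)
        (auto intro!: integrable_measure_pmf_finite finite_set_pmf_random_subset)
    also have "\<dots> \<le> (\<Sum>J\<in>?I. ((card A * p)\<^sup>2) ^ j) * q ^ j"
      using q J by (intro mult_right_mono sum_mono) auto
    also have "\<dots> = real (card F choose j) * ((card A * p)\<^sup>2) ^ j * q ^ j"
      using n_subsets[OF fin(2), of j] by simp
    also have "\<dots> \<le> real (card F ^ j) * ((card A * p)\<^sup>2) ^ j * q ^ j"
      using p q by (intro mult_right_mono of_nat_mono binomial_le_power) auto
    also have "\<dots> = (card F * ((card A * p)\<^sup>2 * q)) ^ j" by (simp add: power_mult_distrib)
    finally show ?thesis using y by (simp add: divide_right_mono)
  qed
  show ?thesis
  proof (rule prob_le_Un[OF _ prob_le_Un[where P = "Q1 \<union> Q2", OF _ 1 2] 3])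
    fix D assume "D \<in> set_pmf ?M" "D \<in> {D. \<not> scattered A F q \<theta> c j y D}"
    moreover from this(1) have D: "D \<subseteq> A \<times> F" by (rule set_pmf_random_subset)
    moreover have "D `` {a} \<inter> F = D `` {a}" for a using D by auto
    ultimately show "D \<in> Q1 \<union> Q2 \<or> D \<in> Q3"
      unfolding scattered_def Q1_def Q2_def Q3_def by fastforce
  qed blast
qed

section \<open>Avoiding conflicts by one of several maps\<close>

lemma prob_pair_random_subset_superset:
  assumes "0 \<le> p" "p \<le> 1" "0 \<le> q" "q \<le> 1" "finite E" "finite E'" "X \<subseteq> E" "Y \<subseteq> E'"
  shows "measure_pmf.prob (pair_pmf (random_subset E p) (random_subset E' q)) {(R, R'). X \<subseteq> R \<and> Y \<subseteq> R'}
    = p ^ card X * q ^ card Y"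
  using prob_pair_Times[of "random_subset E p" "random_subset E' q" "{R. X \<subseteq> R}" "{R. Y \<subseteq> R}"]
  unfolding mem_Collect_eq prob_random_subset_superset[OF assms(1,2,5,7)]
    prob_random_subset_superset[OF assms(3,4,6,8)] .

text \<open>
  Suppose that every map \<open>g i\<close> sends some element of \<open>X\<close> into \<open>Y\<close>. Either a single \<open>e \<in> X\<close> has all
  its \<open>T\<close> images in \<open>Y\<close>, or there are \<open>e \<noteq> e'\<close> in \<open>X\<close> and \<open>i\<close>, \<open>i'\<close> with
  \<open>g i e, g i' e' \<in> Y\<close>. In the latter case the two images may coincide, which costs only one factor
  \<open>q\<close>, but then \<open>e\<close> is determined by \<open>e'\<close>. Using many
  maps matters when \<open>q\<close> is constant: then only a high power of \<open>q\<close> is small.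
\<close>

lemma prob_all_maps_conflict_le:
  fixes p q :: real
  assumes p: "0 \<le> p" "p \<le> 1" and q: "0 \<le> q" "q \<le> 1" and fin: "finite E" and T: "0 < T"
    and maps: "\<And>i. i < T \<Longrightarrow> g i ` E \<subseteq> E" and inj: "\<And>i. i < T \<Longrightarrow> inj_on (g i) E"
    and distinct: "\<And>e. e \<in> E \<Longrightarrow> inj_on (\<lambda>i. g i e) {..<T}"
  shows "measure_pmf.prob (pair_pmf (random_subset E p) (random_subset E q))
      {(X, Y). \<forall>i<T. \<exists>e\<in>X. g i e \<in> Y}
    \<le> card E * (p * q ^ T) + ((real T)\<^sup>2 * ((real (card E))\<^sup>2 * (p\<^sup>2 * q\<^sup>2)) + (real T)\<^sup>2 * (card E * (p\<^sup>2 * q)))"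
proof -
  let ?M = "pair_pmf (random_subset E p) (random_subset E q)"
  define Q1 where "Q1 = {(X, Y). \<exists>e\<in>X. (\<lambda>i. g i e) ` {..<T} \<subseteq> Y}"
  define I where "I = E \<times> E \<times> {..<T} \<times> {..<T}"
  define I2 where "I2 = {(e, e', i, i') \<in> I. e \<noteq> e' \<and> g i e \<noteq> g i' e'}"
  define I3 where "I3 = {(e, e', i, i') \<in> I. e \<noteq> e' \<and> g i e = g i' e'}"
  define Q where "Q = (\<lambda>(e, e', i, i'). {(X, Y). {e, e'} \<subseteq> X \<and> {g i e, g i' e'} \<subseteq> Y})"
  have finI: "finite I" using fin by (simp add: I_def)
  have fin2: "finite I2" "finite I3" unfolding I2_def I3_def by (auto intro: finite_subset[OF _ finI])
  have 1: "measure_pmf.prob ?M Q1 \<le> card E * (p * q ^ T)"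
  proof (rule prob_union_bound_card[OF fin, where Q = "\<lambda>e. {(X, Y). {e} \<subseteq> X \<and> (\<lambda>i. g i e) ` {..<T} \<subseteq> Y}"])
    fix e assume e: "e \<in> E"
    have "measure_pmf.prob ?M {(X, Y). {e} \<subseteq> X \<and> (\<lambda>i. g i e) ` {..<T} \<subseteq> Y}
        = p ^ card {e} * q ^ card ((\<lambda>i. g i e) ` {..<T})"
      using maps e by (intro prob_pair_random_subset_superset p q fin) auto
    also have "\<dots> = p * q ^ T" using card_image[OF distinct[OF e]] by simp
    finally show "measure_pmf.prob ?M {(X, Y). {e} \<subseteq> X \<and> (\<lambda>i. g i e) ` {..<T} \<subseteq> Y} \<le> p * q ^ T" by simp
  qed (auto simp: Q1_def dest!: set_pmf_random_subset)
  have pq: "measure_pmf.prob ?M (Q (e, e', i, i')) = p ^ card {e, e'} * q ^ card {g i e, g i' e'}"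
    if "(e, e', i, i') \<in> I" for e e' i i'
  proof -
    have "{e, e'} \<subseteq> E" "{g i e, g i' e'} \<subseteq> E" using maps that by (auto simp: I_def)
    thus ?thesis unfolding Q_def prod.case by (intro prob_pair_random_subset_superset p q fin)
  qed
  have "measure_pmf.prob ?M (\<Union>x\<in>I2. Q x) \<le> card I2 * (p\<^sup>2 * q\<^sup>2)"
    by (rule prob_union_bound_card[OF fin2(1)]) (use pq in \<open>auto simp: I2_def power2_eq_square\<close>)
  also have "\<dots> \<le> real (T\<^sup>2 * (card E)\<^sup>2) * (p\<^sup>2 * q\<^sup>2)"
  proof -
    have "card I2 \<le> card I" using finI by (intro card_mono) (auto simp: I2_def)
    also have "\<dots> = T\<^sup>2 * (card E)\<^sup>2" by (simp add: I_def card_cartesian_product power2_eq_square)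
    finally show ?thesis using q by (intro mult_right_mono) (simp_all only: of_nat_le_iff zero_le_power2 mult_nonneg_nonneg)
  qed
  finally have 2: "measure_pmf.prob ?M (\<Union>x\<in>I2. Q x) \<le> (real T)\<^sup>2 * ((real (card E))\<^sup>2 * (p\<^sup>2 * q\<^sup>2))" by simp
  have "measure_pmf.prob ?M (\<Union>x\<in>I3. Q x) \<le> card I3 * (p\<^sup>2 * q)"
    by (rule prob_union_bound_card[OF fin2(2)]) (use pq in \<open>auto simp: I3_def power2_eq_square\<close>)
  also have "\<dots> \<le> real (T\<^sup>2 * card E) * (p\<^sup>2 * q)"
  proof -
    \<comment> \<open>\<open>e\<close> is determined by \<open>e'\<close>, \<open>i\<close> and \<open>i'\<close>\<close>
    have "card I3 \<le> card (E \<times> {..<T} \<times> {..<T})"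
    proof (rule card_inj_on_le[where f = snd])
      show "inj_on snd I3"
        using inj by (auto simp: inj_on_def I3_def I_def)
    qed (use fin in \<open>auto simp: I3_def I_def\<close>)
    also have "\<dots> = T\<^sup>2 * card E" by (simp add: card_cartesian_product power2_eq_square)
    finally show ?thesis using q by (intro mult_right_mono) (simp_all only: of_nat_le_iff zero_le_power2 mult_nonneg_nonneg)
  qed
  finally have 3: "measure_pmf.prob ?M (\<Union>x\<in>I3. Q x) \<le> (real T)\<^sup>2 * (card E * (p\<^sup>2 * q))" by simp
  show ?thesis
  proof (rule prob_le_Un[OF _ 1 prob_le_Un[where P = "(\<Union>x\<in>I2. Q x) \<union> (\<Union>x\<in>I3. Q x)", OF _ 2 3]])
    fix R assume R: "R \<in> set_pmf ?M" and all: "R \<in> {(X, Y). \<forall>i<T. \<exists>e\<in>X. g i e \<in> Y}"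
    obtain X Y where XY: "R = (X, Y)" by (cases R)
    have X: "X \<subseteq> E" using R XY by (auto dest: set_pmf_random_subset)
    from all XY have all: "\<And>i. i < T \<Longrightarrow> \<exists>e\<in>X. g i e \<in> Y" by auto
    show "R \<in> Q1 \<or> R \<in> (\<Union>x\<in>I2. Q x) \<union> (\<Union>x\<in>I3. Q x)"
    proof (cases "\<exists>e\<in>X. \<forall>i<T. g i e \<in> Y")
      case True
      thus ?thesis using XY by (auto simp: Q1_def)
    next
      case False
      obtain e where e: "e \<in> X" "g 0 e \<in> Y" using all T by blast
      then obtain i where i: "i < T" "g i e \<notin> Y" using False by blast
      obtain e' where e': "e' \<in> X" "g i e' \<in> Y" using all i by blast
      have "e \<noteq> e'" using i e' by auto
      hence "(e, e', 0, i) \<in> I2 \<union> I3" using e e' i X T by (auto simp: I2_def I3_def I_def)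
      moreover have "R \<in> Q (e, e', 0, i)" using e e' XY by (auto simp: Q_def)
      ultimately show ?thesis by blast
    qed
  qed blast
qed

section \<open>Cyclic shifts of subblocks\<close>

lemma mod_add_right_cancel_nat:
  fixes x y i c :: nat
  shows "(x + i) mod c = (y + i) mod c \<longleftrightarrow> x mod c = y mod c"
  by (simp add: nat_mod_eq_iff)

text \<open>
  The \<open>k + 1\<close> residues \<open>x\<^sub>0 + l * d\<close> with \<open>l \<le> k\<close> are distinct, as \<open>k * d < c\<close>.
\<close>

lemma card_gt_if_closed_under_shift:
  fixes c d k x\<^sub>0 :: nat
  assumes I: "finite I" "x\<^sub>0 \<in> I" and "x\<^sub>0 < c" and closed: "\<And>x. x \<in> I \<Longrightarrow> (x + d) mod c \<in> I"
    and d: "0 < d" "k * d < c"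
  shows "k < card I"
proof -
  have mem: "(x\<^sub>0 + l * d) mod c \<in> I" for l
  proof (induction l)
    case (Suc l)
    have "((x\<^sub>0 + l * d) mod c + d) mod c = (x\<^sub>0 + Suc l * d) mod c"
      by (subst mod_add_left_eq) (simp add: ac_simps)
    with closed[OF Suc.IH] show ?case by simp
  qed (use assms in simp)
  have ne: "(x\<^sub>0 + l * d) mod c \<noteq> (x\<^sub>0 + l' * d) mod c" if "l < l'" "l' \<le> k" for l l'
  proof
    assume "(x\<^sub>0 + l * d) mod c = (x\<^sub>0 + l' * d) mod c"
    hence "c dvd (x\<^sub>0 + l' * d) - (x\<^sub>0 + l * d)" using that by (subst mod_eq_dvd_iff_nat[symmetric]) auto
    hence "c dvd (l' - l) * d" by (simp add: diff_mult_distrib)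
    moreover have "0 < (l' - l) * d" using that d by simp
    moreover have "(l' - l) * d < c"
      using that d(2) mult_le_mono1[of "l' - l" k d] by linarith
    ultimately show False using nat_dvd_not_less by blast
  qed
  have "inj_on (\<lambda>l. (x\<^sub>0 + l * d) mod c) {..k}"
  proof (rule inj_onI)
    fix l l' assume "l \<in> {..k}" "l' \<in> {..k}" "(x\<^sub>0 + l * d) mod c = (x\<^sub>0 + l' * d) mod c"
    thus "l = l'" using ne[of l l'] ne[of l' l] by (cases l l' rule: linorder_cases) auto
  qed
  hence "card {..k} \<le> card I"
    using mem I by (intro card_inj_on_le[of "\<lambda>l. (x\<^sub>0 + l * d) mod c"]) auto
  thus ?thesis by simp
qed

text \<open>
  The map \<open>\<tau> i\<close> sends the subblock \<open>A x\<close> to \<open>A ((x + i) mod c)\<close> by the given bijection. If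
  \<open>\<tau> i\<close> and \<open>\<tau> j\<close> had the same image of \<open>e\<close>, the set of indices of the subblocks met by \<open>e\<close>
  would be invariant under a shift by \<open>j - i\<close> and hence have more than \<open>k\<close> elements. This is the reason
  for requiring \<open>k * T \<le> c\<close>.
\<close>

lemma cyclic_shift_maps:
  fixes A :: "nat \<Rightarrow> 'v set"
  assumes fin: "finite W" "\<And>x. x < c \<Longrightarrow> finite (A x)" and disj: "disjoint_family_on A {..<c}"
    and N: "N = (\<Union>x<c. A x)" "W \<inter> N = {}" and T: "k * T \<le> c"
    and \<sigma>: "\<And>x y. x < c \<Longrightarrow> y < c \<Longrightarrow> bij_betw (\<sigma> x y) (A x) (A y)"
  obtains \<tau> where "\<And>i. bij_betw (\<tau> i) (W \<union> N) (W \<union> N)" "\<And>i v. v \<in> W \<Longrightarrow> \<tau> i v = v"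
    "\<And>i. \<tau> i ` N \<subseteq> N"
    "\<And>i v. v \<in> N \<Longrightarrow> \<exists>x<c. \<exists>y<c. v \<in> A x \<and> \<tau> i v = \<sigma> x y v"
    "\<And>e. finite e \<Longrightarrow> e \<subseteq> W \<union> N \<Longrightarrow> e \<inter> N \<noteq> {} \<Longrightarrow> card e \<le> k \<Longrightarrow> inj_on (\<lambda>i. \<tau> i ` e) {..<T}"
proof -
  define ix where "ix v = (SOME x. x < c \<and> v \<in> A x)" for v
  have ixI: "ix v < c" "v \<in> A (ix v)" if "v \<in> N" for v
    using someI_ex[of "\<lambda>x. x < c \<and> v \<in> A x"] that N unfolding ix_def by auto
  have ix_eq: "ix v = x" if "x < c" "v \<in> A x" for v x
  proof (rule ccontr)
    assume "ix v \<noteq> x"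
    moreover have "v \<in> N" using that N by auto
    ultimately show False using disjoint_family_onD[OF disj, of "ix v" x] ixI[of v] that by auto
  qed
  define \<tau> where "\<tau> i v = (if v \<in> N then \<sigma> (ix v) ((ix v + i) mod c) v else v)" for i v
  have \<tau>A: "\<tau> i v \<in> A ((ix v + i) mod c)" if "v \<in> N" for i v
    using ixI[OF that] that bij_betwE[OF \<sigma>[of "ix v" "(ix v + i) mod c"]] by (auto simp: \<tau>_def)
  have \<tau>N: "\<tau> i v \<in> N" if "v \<in> N" for i v
    using \<tau>A[OF that, of i] ixI[OF that] N by (auto intro: exI[of _ "(ix v + i) mod c"])
  have ix\<tau>: "ix (\<tau> i v) = (ix v + i) mod c" if "v \<in> N" for i v
    using ixI[OF that] by (intro ix_eq \<tau>A that) simp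
  have finN: "finite N" using fin N by auto
  have inj: "inj_on (\<tau> i) (W \<union> N)" for i
  proof (rule inj_onI)
    fix v v' assume v: "v \<in> W \<union> N" "v' \<in> W \<union> N" and eq: "\<tau> i v = \<tau> i v'"
    show "v = v'"
    proof (cases "v \<in> N \<and> v' \<in> N")
      case True
      hence "(ix v + i) mod c = (ix v' + i) mod c" using ix\<tau> eq by metis
      hence ix: "ix v = ix v'"
        using mod_add_right_cancel_nat ixI True by (metis mod_less)
      with eq True have "\<sigma> (ix v) ((ix v + i) mod c) v = \<sigma> (ix v) ((ix v + i) mod c) v'"
        by (simp add: \<tau>_def)
      moreover have "inj_on (\<sigma> (ix v) ((ix v + i) mod c)) (A (ix v))"
        using \<sigma>[of "ix v" "(ix v + i) mod c"] ixI[of v] True by (auto simp: bij_betw_def)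
      ultimately show ?thesis using ixI[of v] ixI[of v'] ix True by (auto dest: inj_onD)
    next
      case False
      have "v \<in> N \<longleftrightarrow> v' \<in> N"
        using eq \<tau>N[of v i] \<tau>N[of v' i] by (metis \<tau>_def)
      thus ?thesis using False eq by (auto simp: \<tau>_def)
    qed
  qed
  have "\<tau> i ` (W \<union> N) \<subseteq> W \<union> N" for i using \<tau>N by (auto simp: \<tau>_def)
  hence img: "\<tau> i ` (W \<union> N) = W \<union> N" for i
    using inj fin finN by (intro endo_inj_surj) auto
  have dist: "inj_on (\<lambda>i. \<tau> i ` e) {..<T}"
    if e: "finite e" "e \<subseteq> W \<union> N" "e \<inter> N \<noteq> {}" "card e \<le> k" for e
  proof -
    have False if ij: "i < j" "j < T" and eq: "\<tau> i ` e = \<tau> j ` e" for i j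
    proof -
      let ?I = "ix ` (e \<inter> N)"
      have memN: "\<tau> l v \<in> N \<longleftrightarrow> v \<in> N" for l v using \<tau>N[of v l] by (auto simp: \<tau>_def)
      have "\<tau> l ` (e \<inter> N) = \<tau> l ` e \<inter> N" for l
        by (auto simp: memN)
      hence eqN: "\<tau> i ` (e \<inter> N) = \<tau> j ` (e \<inter> N)" using eq by simp
      obtain x\<^sub>0 where x0: "x\<^sub>0 \<in> ?I" using e by auto
      have "k < card ?I"
      proof (rule card_gt_if_closed_under_shift[of _ x\<^sub>0 c "j - i"])
        show "x\<^sub>0 < c" using x0 ixI by auto
        have "0 < card e" using e by (auto simp: card_gt_0_iff)
        hence "0 < k" using e by simp
        hence "k * (j - i) < k * T" using ij by simp
        thus "k * (j - i) < c" using T by (rule less_le_trans)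
        fix x assume "x \<in> ?I"
        then obtain v where v: "v \<in> e" "v \<in> N" "x = ix v" by auto
        then obtain v' where v': "v' \<in> e" "v' \<in> N" "\<tau> j v = \<tau> i v'" using eqN by blast
        have "(ix v + (j - i) + i) mod c = (ix v' + i) mod c"
          using ix\<tau>[OF v(2), of j] ix\<tau>[OF v'(2), of i] v'(3) ij by (simp add: add.assoc)
        hence "(x + (j - i)) mod c = ix v'"
          unfolding mod_add_right_cancel_nat using v(3) ixI(1)[OF v'(2)] by simp
        thus "(x + (j - i)) mod c \<in> ?I" using v' by auto
      qed (use x0 e ij in auto)
      also have "card ?I \<le> card (e \<inter> N)" using e by (intro card_image_le) auto
      also have "\<dots> \<le> card e" using e by (intro card_mono) auto
      finally show False using e by simp
    qed
    thus ?thesis by (intro inj_onI) (metis lessThan_iff linorder_neqE_nat)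
  qed
  have loc: "\<exists>x<c. \<exists>y<c. v \<in> A x \<and> \<tau> i v = \<sigma> x y v" if "v \<in> N" for i v
    using ixI[OF that] that by (intro exI[of _ "ix v"] exI[of _ "(ix v + i) mod c"] conjI) (auto simp: \<tau>_def)
  have fix_W: "\<tau> i v = v" if "v \<in> W" for i v using N that by (auto simp: \<tau>_def)
  show ?thesis
  proof (rule that[of \<tau>])
    show "bij_betw (\<tau> i) (W \<union> N) (W \<union> N)" for i using inj img by (simp add: bij_betw_def)
    show "\<tau> i ` N \<subseteq> N" for i using \<tau>N by blast
  qed (rule fix_W loc dist; assumption)+
qed

text \<open>
  The links in the sparser hypergraph are exposed first; once they are scattered, only the randomness
  of the links in the denser hypergraph is used.
\<close>

lemma prob_some_blocks_unmatched_le: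
  fixes p q \<theta> y \<eta> :: real and A :: "nat \<Rightarrow> 'v set" and F :: "'f set"
  assumes q: "0 \<le> q" "q \<le> 1" and fin: "finite N" "finite F"
    and A: "\<And>x. x < b \<Longrightarrow> A x \<subseteq> N" "\<And>x. x < b \<Longrightarrow> card (A x) = m"
    and \<theta>: "0 \<le> \<theta>" "\<theta> \<le> 1" and y0: "0 \<le> y"
    and r: "c * j \<le> r" "r + c * j \<le> m"
    and \<eta>: "measure_pmf.prob (random_subset (N \<times> F) p) {D. \<not> scattered N F q \<theta> c j y D} \<le> \<eta>"
  shows "measure_pmf.prob (pair_pmf (random_subset (N \<times> F) p) (random_subset (N \<times> F) q))
      {(D, R). \<exists>x<b. \<exists>x'<b. \<not> (\<exists>\<sigma>. bij_betw \<sigma> (A x) (A x') \<and> (\<forall>a\<in>A x. R `` {\<sigma> a} \<inter> D `` {a} = {}))}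
    \<le> \<eta> + (real b)\<^sup>2 * (m * (m ^ r * (1 - \<theta>) ^ (m - r))
        + m * (y + m ^ (r + c * j) * (1 - \<theta>) ^ (m - (r + c * j)))
        + m ^ (2 * r) * (y + r ^ (c * j) * (1 - \<theta>) ^ (r - c * j)) ^ r)"
    (is "measure_pmf.prob _ ?Q \<le> \<eta> + (real b)\<^sup>2 * ?\<beta>")
proof -
  have \<beta>: "0 \<le> ?\<beta>" using y0 \<theta> by simp
  have "measure_pmf.prob (pair_pmf (random_subset (N \<times> F) p) (random_subset (N \<times> F) q)) ?Q
      \<le> measure_pmf.prob (random_subset (N \<times> F) p) {D. \<not> scattered N F q \<theta> c j y D} + (real b)\<^sup>2 * ?\<beta>"
  proof (rule prob_pair_le)
    fix D assume "D \<notin> {D. \<not> scattered N F q \<theta> c j y D}"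
    hence D: "scattered N F q \<theta> c j y D" by simp
    let ?Q' = "\<lambda>x x'. {R. \<not> (\<exists>\<sigma>. bij_betw \<sigma> (A x) (A x') \<and> (\<forall>a\<in>A x. R `` {\<sigma> a} \<inter> D `` {a} = {}))}"
    have "measure_pmf.prob (random_subset (N \<times> F) q) {R. (D, R) \<in> ?Q} \<le> card ({..<b} \<times> {..<b}) * ?\<beta>"
    proof (rule prob_union_bound_card[where Q = "\<lambda>(x, x'). ?Q' x x'"])
      fix i assume "i \<in> {..<b} \<times> {..<b}"
      then obtain x x' where "i = (x, x')" "x < b" "x' < b" by auto
      thus "measure_pmf.prob (random_subset (N \<times> F) q) (case i of (x, x') \<Rightarrow> ?Q' x x') \<le> ?\<beta>"
        using prob_no_matching_le[OF q fin(1,2,1) D \<theta> y0 A(1,2) A(1,2) r, of x x'] by simp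
    qed auto
    thus "measure_pmf.prob (random_subset (N \<times> F) q) {R. (D, R) \<in> ?Q} \<le> (real b)\<^sup>2 * ?\<beta>"
      by (simp add: card_cartesian_product power2_eq_square)
  qed (use \<beta> in simp)
  thus ?thesis using \<eta> by linarith
qed

section \<open>Extending a packing by a block of vertices\<close>

definition new_edges :: "'v set \<Rightarrow> 'v set \<Rightarrow> nat \<Rightarrow> 'v set set" where
  "new_edges W N k = nsets (W \<union> N) k - nsets W k"

lemma new_edges_meet: "e \<in> new_edges W N k \<longleftrightarrow> e \<in> nsets (W \<union> N) k \<and> e \<inter> N \<noteq> {}" if "W \<inter> N = {}"
  using that by (auto simp: new_edges_def nsets_def)

text \<open>
  An edge with exactly one new vertex is the same as a new vertex together with an element of its link.
\<close>

lemma singly_attached_edges_eq: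
  assumes "W \<inter> N = {}" "finite W" "finite N" "0 < k"
  shows "{e \<in> nsets (W \<union> N) k. card (e \<inter> N) = 1} = (\<lambda>(a, f). insert a f) ` (N \<times> nsets W (k - 1))"
    and "inj_on (\<lambda>(a, f). insert a f) (N \<times> nsets W (k - 1))"
proof -
  show "{e \<in> nsets (W \<union> N) k. card (e \<inter> N) = 1} = (\<lambda>(a, f). insert a f) ` (N \<times> nsets W (k - 1))"
  proof (intro set_eqI iffI)
    fix e assume "e \<in> {e \<in> nsets (W \<union> N) k. card (e \<inter> N) = 1}"
    hence e: "e \<subseteq> W \<union> N" "finite e" "card e = k" "card (e \<inter> N) = 1" by (auto simp: nsets_def)
    then obtain a where a: "e \<inter> N = {a}" by (auto simp: card_1_singleton_iff)
    hence "a \<in> e" "a \<in> N" "e - {a} \<subseteq> W" using e(1) by auto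
    thus "e \<in> (\<lambda>(a, f). insert a f) ` (N \<times> nsets W (k - 1))"
      using e by (intro image_eqI[of _ _ "(a, e - {a})"]) (auto simp: nsets_def)
  next
    fix e assume "e \<in> (\<lambda>(a, f). insert a f) ` (N \<times> nsets W (k - 1))"
    then obtain a f where e: "e = insert a f" "a \<in> N" "f \<subseteq> W" "finite f" "card f = k - 1"
      by (auto simp: nsets_def)
    have "a \<notin> f" "e \<inter> N = {a}" using e assms by auto
    thus "e \<in> {e \<in> nsets (W \<union> N) k. card (e \<inter> N) = 1}"
      using e assms by (auto simp: nsets_def)
  qed
  show "inj_on (\<lambda>(a, f). insert a f) (N \<times> nsets W (k - 1))"
  proof (rule inj_onI)
    fix u v assume "u \<in> N \<times> nsets W (k - 1)" "v \<in> N \<times> nsets W (k - 1)"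
      "(\<lambda>(a, f). insert a f) u = (\<lambda>(a, f). insert a f) v"
    then obtain a f a' f' where uv: "u = (a, f)" "v = (a', f')"
      and h: "a \<in> N" "a' \<in> N" "f \<in> nsets W (k - 1)" "f' \<in> nsets W (k - 1)" "insert a f = insert a' f'"
      by auto
    have "f \<subseteq> W" "f' \<subseteq> W" using h by (auto simp: nsets_def)
    hence "a \<notin> f'" "a' \<notin> f" "a \<notin> f" "a' \<notin> f'" using h assms by auto
    thus "u = v" using h(5) uv by auto
  qed
qed

lemma card_multiply_attached_edges_le:
  assumes "finite V" "N \<subseteq> V"
  shows "card {e \<in> nsets V k. 2 \<le> card (e \<inter> N)} \<le> (card N)\<^sup>2 * card V ^ (k - 2)"
proof -
  have finN: "finite N" using assms finite_subset by blast
  have "{e \<in> nsets V k. 2 \<le> card (e \<inter> N)} \<subseteq> (\<lambda>(a, b, f). {a, b} \<union> f) ` (N \<times> N \<times> nsets V (k - 2))"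
  proof
    fix e assume "e \<in> {e \<in> nsets V k. 2 \<le> card (e \<inter> N)}"
    hence e: "e \<subseteq> V" "finite e" "card e = k" "2 \<le> card (e \<inter> N)" by (auto simp: nsets_def)
    from ex_subset_card_eq[OF e(4)] obtain S where "S \<subseteq> e \<inter> N" "card S = 2" by blast
    then obtain a b where ab: "a \<in> e \<inter> N" "b \<in> e \<inter> N" "a \<noteq> b" by (auto simp: card_2_iff)
    hence "card (e - {a, b}) = k - 2" using e by (subst card_Diff_subset) auto
    thus "e \<in> (\<lambda>(a, b, f). {a, b} \<union> f) ` (N \<times> N \<times> nsets V (k - 2))"
      using ab e by (intro image_eqI[of _ _ "(a, b, e - {a, b})"]) (auto simp: nsets_def)
  qed
  hence "card {e \<in> nsets V k. 2 \<le> card (e \<inter> N)} \<le> card (N \<times> N \<times> nsets V (k - 2))"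
    using assms finN by (intro surj_card_le finite_cartesian_product finite_imp_finite_nsets)
  also have "\<dots> = (card N)\<^sup>2 * card (nsets V (k - 2))"
    by (simp add: card_cartesian_product power2_eq_square)
  also have "card (nsets V (k - 2)) = card V choose (k - 2)" by simp
  also have "(card N)\<^sup>2 * (card V choose (k - 2)) \<le> (card N)\<^sup>2 * card V ^ (k - 2)"
    by (intro mult_le_mono2 binomial_le_power)
  finally show ?thesis .
qed

text \<open>
  The edges with exactly one new vertex are exposed first and yield, outside a bad event, all the
  matchings between subblocks and thereby the shifts \<open>\<tau> i\<close>, none of which creates a collision between
  such edges. The edges with more new vertices are still random, and \<open>prob_all_maps_conflict_le\<close> finds
  a shift that also avoids collisions among them. An edge of one kind is never mapped to one of the other kind.
\<close>

lemma prob_no_extension_fixing_old_le: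
  fixes p q \<theta> y \<eta> \<beta> :: real and A :: "nat \<Rightarrow> 'v set"
  assumes p: "0 \<le> p" "p \<le> 1" and q: "0 \<le> q" "q \<le> 1" and finW: "finite W"
    and A: "\<And>x. x < b \<Longrightarrow> finite (A x)" "\<And>x. x < b \<Longrightarrow> card (A x) = m" "disjoint_family_on A {..<b}"
    and N: "N = (\<Union>x<b. A x)" "W \<inter> N = {}" and k: "2 \<le> k" and T: "0 < T" "k * T \<le> b"
    and \<theta>: "0 \<le> \<theta>" "\<theta> \<le> 1" and y0: "0 \<le> y" and r: "c * j \<le> r" "r + c * j \<le> m"
    and \<eta>: "measure_pmf.prob (random_subset (N \<times> nsets W (k - 1)) p)
        {D. \<not> scattered N (nsets W (k - 1)) q \<theta> c j y D} \<le> \<eta>"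
    and \<beta>: "real m * (real m ^ r * (1 - \<theta>) ^ (m - r))
        + real m * (y + real m ^ (r + c * j) * (1 - \<theta>) ^ (m - (r + c * j)))
        + real m ^ (2 * r) * (y + real r ^ (c * j) * (1 - \<theta>) ^ (r - c * j)) ^ r \<le> \<beta>"
    and K: "K = (card N)\<^sup>2 * card (W \<union> N) ^ (k - 2)"
  shows "measure_pmf.prob (pair_pmf (random_subset (new_edges W N k) p) (random_subset (new_edges W N k) q))
      {(X, Y). \<not> (\<exists>\<tau>. bij_betw \<tau> (W \<union> N) (W \<union> N) \<and> (\<forall>v\<in>W. \<tau> v = v) \<and> \<tau> ` N \<subseteq> N \<and> (\<forall>e\<in>X. \<tau> ` e \<notin> Y))}
    \<le> \<eta> + (real b)\<^sup>2 * \<beta> + (K * (p * q ^ T) + ((real T)\<^sup>2 * ((real K)\<^sup>2 * (p\<^sup>2 * q\<^sup>2)) + (real T)\<^sup>2 * (K * (p\<^sup>2 * q))))"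
proof -
  define F where "F = nsets W (k - 1)"
  define ins where "ins = (\<lambda>(a :: 'v, f). insert a f)"
  define E1 where "E1 = {e \<in> nsets (W \<union> N) k. card (e \<inter> N) = 1}"
  define E2 where "E2 = {e \<in> nsets (W \<union> N) k. 2 \<le> card (e \<inter> N)}"
  have finN: "finite N" using A N by auto
  have finF: "finite F" unfolding F_def using finW by (rule finite_imp_finite_nsets)
  have fin: "finite (nsets (W \<union> N) k)" using finW finN by (intro finite_imp_finite_nsets) auto
  have finE: "finite E1" "finite E2" unfolding E1_def E2_def using fin by auto
  have E12: "E1 \<inter> E2 = {}" unfolding E1_def E2_def by auto
  have new: "new_edges W N k = E1 \<union> E2"
  proof -
    have iff: "e \<inter> N \<noteq> {} \<longleftrightarrow> card (e \<inter> N) = 1 \<or> 2 \<le> card (e \<inter> N)" for e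
    proof -
      have "e \<inter> N \<noteq> {} \<longleftrightarrow> 0 < card (e \<inter> N)" using finN by (simp add: card_gt_0_iff)
      thus ?thesis by linarith
    qed
    show ?thesis unfolding E1_def E2_def by (intro set_eqI) (simp add: new_edges_meet[OF N(2)] iff conj_disj_distribL)
  qed
  have E1: "E1 = ins ` (N \<times> F)" and inj: "inj_on ins (N \<times> F)"
    using singly_attached_edges_eq[OF N(2) finW finN, of k] k unfolding E1_def F_def ins_def by auto
  have cardE2: "card E2 \<le> K"
    unfolding E2_def K using finW finN by (intro card_multiply_attached_edges_le) auto
  define Bad where "Bad = {(X, Y). \<exists>x<b. \<exists>x'<b. \<not> (\<exists>\<sigma>. bij_betw \<sigma> (A x) (A x') \<and>
    (\<forall>a\<in>A x. \<forall>f\<in>F. \<not> (ins (a, f) \<in> X \<and> ins (\<sigma> a, f) \<in> Y)))}"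
  have AN: "A x \<subseteq> N" if "x < b" for x using N that by auto
  have Bad: "measure_pmf.prob (pair_pmf (random_subset E1 p) (random_subset E1 q)) Bad \<le> \<eta> + (real b)\<^sup>2 * \<beta>"
  proof -
    have "pair_pmf (random_subset E1 p) (random_subset E1 q)
      = map_pmf (\<lambda>(D, R). (ins ` D, ins ` R)) (pair_pmf (random_subset (N \<times> F) p) (random_subset (N \<times> F) q))"
      unfolding map_pair E1 using finN finF inj by (simp add: random_subset_image)
    hence "measure_pmf.prob (pair_pmf (random_subset E1 p) (random_subset E1 q)) Bad
        = measure_pmf.prob (pair_pmf (random_subset (N \<times> F) p) (random_subset (N \<times> F) q)) {(D, R). (ins ` D, ins ` R) \<in> Bad}"
      by (simp add: vimage_def case_prod_unfold)
    also have "\<dots> \<le> measure_pmf.prob (pair_pmf (random_subset (N \<times> F) p) (random_subset (N \<times> F) q))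
      {(D, R). \<exists>x<b. \<exists>x'<b. \<not> (\<exists>\<sigma>. bij_betw \<sigma> (A x) (A x') \<and> (\<forall>a\<in>A x. R `` {\<sigma> a} \<inter> D `` {a} = {}))}"
    proof (rule prob_le_if)
      fix DR assume DR: "DR \<in> set_pmf (pair_pmf (random_subset (N \<times> F) p) (random_subset (N \<times> F) q))"
        "DR \<in> {(D, R). (ins ` D, ins ` R) \<in> Bad}"
      obtain D R where eq: "DR = (D, R)" by (cases DR)
      have sub: "D \<subseteq> N \<times> F" "R \<subseteq> N \<times> F" using DR(1) eq by (auto dest: set_pmf_random_subset)
      have mem: "ins (a, f) \<in> ins ` Z \<longleftrightarrow> (a, f) \<in> Z" if "a \<in> N" "f \<in> F" "Z \<subseteq> N \<times> F" for a f Z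
        using inj_on_image_mem_iff[OF inj, of "(a, f)" Z] that by auto
      from DR(2) eq obtain x x' where x: "x < b" "x' < b" and no: "\<And>\<sigma>. bij_betw \<sigma> (A x) (A x') \<Longrightarrow>
          \<exists>a\<in>A x. \<exists>f\<in>F. ins (a, f) \<in> ins ` D \<and> ins (\<sigma> a, f) \<in> ins ` R"
        unfolding Bad_def by simp blast
      have "\<exists>a\<in>A x. R `` {\<sigma> a} \<inter> D `` {a} \<noteq> {}" if \<sigma>: "bij_betw \<sigma> (A x) (A x')" for \<sigma>
      proof -
        from no[OF \<sigma>] obtain a f where a: "a \<in> A x" "f \<in> F" "ins (a, f) \<in> ins ` D" "ins (\<sigma> a, f) \<in> ins ` R"
          by blast
        have N': "a \<in> N" using AN[OF x(1)] a(1) by auto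
        have "\<sigma> a \<in> A x'" using bij_betwE[OF \<sigma>] a(1) by auto
        hence "\<sigma> a \<in> N" using AN[OF x(2)] by auto
        hence "(a, f) \<in> D" "(\<sigma> a, f) \<in> R" using mem[OF _ a(2)] N' a(3,4) sub by auto
        thus ?thesis using a(1) by blast
      qed
      thus "DR \<in> {(D, R). \<exists>x<b. \<exists>x'<b. \<not> (\<exists>\<sigma>. bij_betw \<sigma> (A x) (A x') \<and> (\<forall>a\<in>A x. R `` {\<sigma> a} \<inter> D `` {a} = {}))}"
        using x eq by blast
    qed
    also have "\<dots> \<le> \<eta> + (real b)\<^sup>2 * (real m * (real m ^ r * (1 - \<theta>) ^ (m - r))
        + real m * (y + real m ^ (r + c * j) * (1 - \<theta>) ^ (m - (r + c * j)))
        + real m ^ (2 * r) * (y + real r ^ (c * j) * (1 - \<theta>) ^ (r - c * j)) ^ r)"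
      using \<eta> by (intro prob_some_blocks_unmatched_le[OF q finN finF AN A(2) \<theta> y0 r]) (simp_all add: F_def)
    also have "\<dots> \<le> \<eta> + (real b)\<^sup>2 * \<beta>"
      using \<beta> by (intro add_left_mono mult_left_mono) auto
    finally show ?thesis .
  qed
  define Fail where "Fail = {(X, Y). \<not> (\<exists>\<tau>. bij_betw \<tau> (W \<union> N) (W \<union> N) \<and> (\<forall>v\<in>W. \<tau> v = v) \<and>
    \<tau> ` N \<subseteq> N \<and> (\<forall>e\<in>X. \<tau> ` e \<notin> Y))}"
  define \<gamma> where "\<gamma> = K * (p * q ^ T) + ((real T)\<^sup>2 * ((real K)\<^sup>2 * (p\<^sup>2 * q\<^sup>2)) + (real T)\<^sup>2 * (K * (p\<^sup>2 * q)))"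
  have "measure_pmf.prob (pair_pmf (random_subset (new_edges W N k) p) (random_subset (new_edges W N k) q)) Fail
      = measure_pmf.prob (pair_pmf (pair_pmf (random_subset E1 p) (random_subset E1 q))
                                   (pair_pmf (random_subset E2 p) (random_subset E2 q)))
          {((X, Y), (X', Y')). (X \<union> X', Y \<union> Y') \<in> Fail}"
    unfolding new pair_random_subset_Un[OF finE E12] by (simp add: vimage_def case_prod_unfold)
  also have "\<dots> \<le> measure_pmf.prob (pair_pmf (random_subset E1 p) (random_subset E1 q)) Bad + \<gamma>"
  proof (rule prob_pair_le)
    show "0 \<le> \<gamma>" using p q by (simp add: \<gamma>_def)
    fix XY assume XY: "XY \<in> set_pmf (pair_pmf (random_subset E1 p) (random_subset E1 q))" "XY \<notin> Bad"
    obtain X Y where eq: "XY = (X, Y)" by (cases XY)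
    have X: "X \<subseteq> E1" and Y: "Y \<subseteq> E1" using XY eq by (auto dest: set_pmf_random_subset)
    have "\<forall>x x'. \<exists>\<sigma>. x < b \<longrightarrow> x' < b \<longrightarrow> bij_betw \<sigma> (A x) (A x') \<and>
        (\<forall>a\<in>A x. \<forall>f\<in>F. \<not> (ins (a, f) \<in> X \<and> ins (\<sigma> a, f) \<in> Y))"
      using XY(2) unfolding eq Bad_def by blast
    then obtain \<sigma> where \<sigma>: "\<And>x x'. x < b \<Longrightarrow> x' < b \<Longrightarrow> bij_betw (\<sigma> x x') (A x) (A x')"
      and avoid: "\<And>x x' a f. x < b \<Longrightarrow> x' < b \<Longrightarrow> a \<in> A x \<Longrightarrow> f \<in> F \<Longrightarrow> ins (a, f) \<in> X \<Longrightarrow> ins (\<sigma> x x' a, f) \<notin> Y"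
      by metis
    obtain \<tau> where \<tau>: "\<And>i. bij_betw (\<tau> i) (W \<union> N) (W \<union> N)" and \<tau>W: "\<And>i v. v \<in> W \<Longrightarrow> \<tau> i v = v"
      and \<tau>N: "\<And>i. \<tau> i ` N \<subseteq> N"
      and loc: "\<And>i v. v \<in> N \<Longrightarrow> \<exists>x<b. \<exists>x'<b. v \<in> A x \<and> \<tau> i v = \<sigma> x x' v"
      and dist: "\<And>e. finite e \<Longrightarrow> e \<subseteq> W \<union> N \<Longrightarrow> e \<inter> N \<noteq> {} \<Longrightarrow> card e \<le> k \<Longrightarrow> inj_on (\<lambda>i. \<tau> i ` e) {..<T}"
      using cyclic_shift_maps[OF finW A(1) A(3) N T(2) \<sigma>] by blast
    have \<tau>inj: "inj_on (\<tau> i) (W \<union> N)" for i using \<tau> by (auto simp: bij_betw_def)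
    have cardN: "card (\<tau> i ` e \<inter> N) = card (e \<inter> N)" if "e \<subseteq> W \<union> N" for i e
    proof -
      have "\<tau> i v \<in> N \<longleftrightarrow> v \<in> N" if "v \<in> W \<union> N" for v
        using that \<tau>W[of v i] \<tau>N[of i] N(2) by (metis IntI UnE empty_iff image_subset_iff)
      hence "\<tau> i ` e \<inter> N = \<tau> i ` (e \<inter> N)" using that by auto
      thus ?thesis using that by (simp add: card_image inj_on_subset[OF \<tau>inj] le_infI1)
    qed
    have \<tau>E2: "(`) (\<tau> i) ` E2 \<subseteq> E2" for i
    proof safe
      fix e assume "e \<in> E2"
      hence e: "e \<subseteq> W \<union> N" "finite e" "card e = k" "2 \<le> card (e \<inter> N)" by (auto simp: E2_def nsets_def)
      have "card (\<tau> i ` e) = k" using e by (simp add: card_image inj_on_subset[OF \<tau>inj])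
      moreover have "\<tau> i ` e \<subseteq> W \<union> N" using e(1) \<tau>[of i] by (auto simp: bij_betw_def)
      ultimately show "\<tau> i ` e \<in> E2" using e cardN[OF e(1), of i] by (simp add: E2_def nsets_def)
    qed
    have "measure_pmf.prob (pair_pmf (random_subset E2 p) (random_subset E2 q))
        {XY'. (XY, XY') \<in> {((X, Y), (X', Y')). (X \<union> X', Y \<union> Y') \<in> Fail}}
      \<le> measure_pmf.prob (pair_pmf (random_subset E2 p) (random_subset E2 q))
        {(X', Y'). \<forall>i<T. \<exists>e\<in>X'. \<tau> i ` e \<in> Y'}"
    proof (rule prob_le_if)
      fix XY' assume XY': "XY' \<in> set_pmf (pair_pmf (random_subset E2 p) (random_subset E2 q))"
        "XY' \<in> {XY'. (XY, XY') \<in> {((X, Y), (X', Y')). (X \<union> X', Y \<union> Y') \<in> Fail}}"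
      obtain X' Y' where eq': "XY' = (X', Y')" by (cases XY')
      have X': "X' \<subseteq> E2" and Y': "Y' \<subseteq> E2" using XY'(1) eq' by (auto dest: set_pmf_random_subset)
      have fail: "(X \<union> X', Y \<union> Y') \<in> Fail" using XY'(2) eq eq' by simp
      have "\<exists>e\<in>X'. \<tau> i ` e \<in> Y'" for i
      proof (rule ccontr)
        assume no: "\<not> ?thesis"
        have "\<tau> i ` e \<notin> Y \<union> Y'" if "e \<in> X \<union> X'" for e
        proof (cases "e \<in> X'")
          case True
          hence "\<tau> i ` e \<in> E2" using \<tau>E2 X' by blast
          thus ?thesis using no True Y E12 by auto
        next
          case False
          hence eX: "e \<in> X" using that by simp
          hence "e \<in> E1" using X by auto
          then obtain a f where e: "e = ins (a, f)" "a \<in> N" "f \<in> F" unfolding E1 by auto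
          have "f \<subseteq> W" using e by (auto simp: F_def nsets_def)
          hence "\<tau> i ` f = (\<lambda>v. v) ` f" using \<tau>W by (intro image_cong) auto
          hence img: "\<tau> i ` e = ins (\<tau> i a, f)" using e by (simp add: ins_def)
          have "\<tau> i a \<in> N" using e \<tau>N by blast
          hence "\<tau> i ` e \<in> E1" unfolding img E1 using e by auto
          hence "\<tau> i ` e \<notin> Y'" using Y' E12 by auto
          moreover have "\<tau> i ` e \<notin> Y"
            using loc[OF e(2), of i] avoid[of _ _ a f] e eX img by metis
          ultimately show ?thesis by simp
        qed
        hence "(X \<union> X', Y \<union> Y') \<notin> Fail" unfolding Fail_def using \<tau>[of i] \<tau>W[of _ i] \<tau>N[of i] by auto
        thus False using fail by simp
      qed
      thus "XY' \<in> {(X', Y'). \<forall>i<T. \<exists>e\<in>X'. \<tau> i ` e \<in> Y'}" using eq' by simp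
    qed
    also have "\<dots> \<le> card E2 * (p * q ^ T) + ((real T)\<^sup>2 * ((real (card E2))\<^sup>2 * (p\<^sup>2 * q\<^sup>2)) + (real T)\<^sup>2 * (card E2 * (p\<^sup>2 * q)))"
    proof (rule prob_all_maps_conflict_le[OF p q finE(2) T(1) \<tau>E2])
      show "inj_on ((`) (\<tau> i)) E2" for i
        using \<tau>inj[of i] by (intro inj_onI) (auto simp: E2_def nsets_def inj_on_image_eq_iff)
      fix e assume "e \<in> E2"
      hence "e \<subseteq> W \<union> N" "finite e" "card e = k" "e \<inter> N \<noteq> {}" by (auto simp: E2_def nsets_def)
      thus "inj_on (\<lambda>i. \<tau> i ` e) {..<T}" by (intro dist) auto
    qed
    also have "\<dots> \<le> \<gamma>"
      unfolding \<gamma>_def using p q cardE2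
      by (intro add_mono mult_left_mono mult_right_mono power_mono) auto
    finally show "measure_pmf.prob (pair_pmf (random_subset E2 p) (random_subset E2 q))
        {XY'. (XY, XY') \<in> {((X, Y), (X', Y')). (X \<union> X', Y \<union> Y') \<in> Fail}} \<le> \<gamma>" .
  qed
  finally show ?thesis using Bad unfolding \<gamma>_def Fail_def by linarith
qed

definition prob_unpackable :: "'v set \<Rightarrow> nat \<Rightarrow> real \<Rightarrow> real \<Rightarrow> real" where
  "prob_unpackable V k p q =
    measure_pmf.prob (pair_pmf (random_subset (nsets V k) p) (random_subset (nsets V k) q))
      {(X, Y). \<not> (\<exists>\<phi>. bij_betw \<phi> V V \<and> (\<forall>e\<in>X. \<phi> ` e \<notin> Y))}"

text \<open>
  A packing \<open>\<phi>\<close> of the old parts depends on the old edges only. Applying it to the vertices of the second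
  hypergraph preserves the distribution of the new edges, and transforms extensions of the identity into
  extensions of \<open>\<phi>\<close>.
\<close>

lemma prob_unpackable_extend:
  fixes p q \<gamma> :: real
  assumes fin: "finite W" "finite N" and WN: "W \<inter> N = {}"
    and \<gamma>: "measure_pmf.prob (pair_pmf (random_subset (new_edges W N k) p) (random_subset (new_edges W N k) q))
      {(X, Y). \<not> (\<exists>\<tau>. bij_betw \<tau> (W \<union> N) (W \<union> N) \<and> (\<forall>v\<in>W. \<tau> v = v) \<and> \<tau> ` N \<subseteq> N \<and> (\<forall>e\<in>X. \<tau> ` e \<notin> Y))}
      \<le> \<gamma>"
  shows "prob_unpackable (W \<union> N) k p q \<le> prob_unpackable W k p q + \<gamma>"
proof -
  define E where "E = new_edges W N k"
  define Fail where "Fail = {(X, Y). \<not> (\<exists>\<phi>. bij_betw \<phi> (W \<union> N) (W \<union> N) \<and> (\<forall>e\<in>X. \<phi> ` e \<notin> Y))}"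
  define Fix where "Fix = {(X, Y). \<not> (\<exists>\<tau>. bij_betw \<tau> (W \<union> N) (W \<union> N) \<and> (\<forall>v\<in>W. \<tau> v = v) \<and> \<tau> ` N \<subseteq> N \<and>
    (\<forall>e\<in>X. \<tau> ` e \<notin> Y))}"
  have finE: "finite (nsets W k)" "finite E"
    unfolding E_def new_edges_def using fin by (auto intro: finite_imp_finite_nsets)
  have split: "nsets (W \<union> N) k = nsets W k \<union> E" "nsets W k \<inter> E = {}"
    unfolding E_def new_edges_def using nsets_mono[of W "W \<union> N" k] by auto
  have memE: "e \<in> E \<longleftrightarrow> e \<subseteq> W \<union> N \<and> finite e \<and> card e = k \<and> e \<inter> N \<noteq> {}" for e
    unfolding E_def new_edges_meet[OF WN] by (auto simp: nsets_def)
  have "prob_unpackable (W \<union> N) k p q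
      = measure_pmf.prob (pair_pmf (pair_pmf (random_subset (nsets W k) p) (random_subset (nsets W k) q))
                                   (pair_pmf (random_subset E p) (random_subset E q)))
          {((X, Y), (X', Y')). (X \<union> X', Y \<union> Y') \<in> Fail}"
    unfolding prob_unpackable_def split(1) pair_random_subset_Un[OF finE split(2)] Fail_def[symmetric]
    by (simp add: vimage_def case_prod_unfold)
  also have "\<dots> \<le> measure_pmf.prob (pair_pmf (random_subset (nsets W k) p) (random_subset (nsets W k) q))
      {(X, Y). \<not> (\<exists>\<phi>. bij_betw \<phi> W W \<and> (\<forall>e\<in>X. \<phi> ` e \<notin> Y))} + \<gamma>"
  proof (rule prob_pair_le)
    show "0 \<le> \<gamma>" using \<gamma> measure_nonneg order_trans by blast
    fix XY assume XY: "XY \<in> set_pmf (pair_pmf (random_subset (nsets W k) p) (random_subset (nsets W k) q))"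
      "XY \<notin> {(X, Y). \<not> (\<exists>\<phi>. bij_betw \<phi> W W \<and> (\<forall>e\<in>X. \<phi> ` e \<notin> Y))}"
    obtain X Y where eq: "XY = (X, Y)" by (cases XY)
    have X: "X \<subseteq> nsets W k" and Y: "Y \<subseteq> nsets W k" using XY(1) eq by (auto dest: set_pmf_random_subset)
    obtain \<phi> where \<phi>: "bij_betw \<phi> W W" "\<And>e. e \<in> X \<Longrightarrow> \<phi> ` e \<notin> Y" using XY(2) eq by auto
    define \<Phi> where "\<Phi> v = (if v \<in> W then \<phi> v else v)" for v
    have \<Phi>W: "bij_betw \<Phi> W W" using \<phi>(1) by (rule bij_betw_cong[THEN iffD1, rotated]) (simp add: \<Phi>_def)
    have \<Phi>N: "\<Phi> ` S = S" if "S \<subseteq> N" for S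
    proof -
      have "\<Phi> ` S = (\<lambda>v. v) ` S" using that WN by (intro image_cong) (auto simp: \<Phi>_def)
      thus ?thesis by simp
    qed
    have \<Phi>: "bij_betw \<Phi> (W \<union> N) (W \<union> N)"
    proof (rule bij_betw_combine[OF \<Phi>W _ WN])
      show "bij_betw \<Phi> N N" using \<Phi>N[of N] WN by (auto simp: bij_betw_def inj_on_def \<Phi>_def)
    qed
    have inj: "inj_on \<Phi> (W \<union> N)" using \<Phi> by (simp add: bij_betw_def)
    have inj_img: "inj_on ((`) \<Phi>) E"
      using inj by (intro inj_onI) (auto simp: memE inj_on_image_eq_iff)
    have "(`) \<Phi> ` E \<subseteq> E"
    proof safe
      fix e assume e: "e \<in> E"
      have "\<Phi> ` e \<subseteq> W \<union> N" using e \<Phi> by (auto simp: memE bij_betw_def)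
      moreover have "inj_on \<Phi> e" using e inj by (auto simp: memE intro: inj_on_subset)
      hence "card (\<Phi> ` e) = k" using e by (simp add: memE card_image)
      moreover have "\<Phi> ` (e \<inter> N) = e \<inter> N" by (rule \<Phi>N) simp
      hence "\<Phi> ` e \<inter> N \<noteq> {}" using e by (auto simp: memE)
      ultimately show "\<Phi> ` e \<in> E" using e by (simp add: memE)
    qed
    hence img: "(`) \<Phi> ` E = E" using inj_img finE by (intro endo_inj_surj) auto
    have "random_subset E q = map_pmf ((`) ((`) \<Phi>)) (random_subset E q)"
      using random_subset_image[OF finE(2) inj_img, of q] img by simp
    hence "pair_pmf (random_subset E p) (random_subset E q)
        = map_pmf (\<lambda>(X', Y'). (X', (`) \<Phi> ` Y')) (pair_pmf (random_subset E p) (random_subset E q))"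
      using map_pair[of "\<lambda>x. x" "(`) ((`) \<Phi>)" "random_subset E p" "random_subset E q"]
      by (simp add: pmf.map_ident)
    hence "measure_pmf.prob (pair_pmf (random_subset E p) (random_subset E q))
        {XY'. (XY, XY') \<in> {((X, Y), (X', Y')). (X \<union> X', Y \<union> Y') \<in> Fail}}
      = measure_pmf.prob (map_pmf (\<lambda>(X', Y'). (X', (`) \<Phi> ` Y')) (pair_pmf (random_subset E p) (random_subset E q)))
        {XY'. (XY, XY') \<in> {((X, Y), (X', Y')). (X \<union> X', Y \<union> Y') \<in> Fail}}"
      by simp
    also have "\<dots> = measure_pmf.prob (pair_pmf (random_subset E p) (random_subset E q))
        {(X', Y'). (X \<union> X', Y \<union> (`) \<Phi> ` Y') \<in> Fail}"
      unfolding measure_map_pmf by (simp add: vimage_def case_prod_unfold eq)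
    also have "\<dots> \<le> measure_pmf.prob (pair_pmf (random_subset E p) (random_subset E q)) Fix"
    proof (rule prob_le_if)
      fix XY' assume XY': "XY' \<in> set_pmf (pair_pmf (random_subset E p) (random_subset E q))"
        "XY' \<in> {(X', Y'). (X \<union> X', Y \<union> (`) \<Phi> ` Y') \<in> Fail}"
      obtain X' Y' where eq': "XY' = (X', Y')" by (cases XY')
      have X': "X' \<subseteq> E" and Y': "Y' \<subseteq> E" using XY'(1) eq' by (auto dest: set_pmf_random_subset)
      show "XY' \<in> Fix"
      proof (rule ccontr)
        assume "XY' \<notin> Fix"
        then obtain \<tau> where \<tau>: "bij_betw \<tau> (W \<union> N) (W \<union> N)" "\<And>v. v \<in> W \<Longrightarrow> \<tau> v = v" "\<tau> ` N \<subseteq> N"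
          and avoid: "\<And>e. e \<in> X' \<Longrightarrow> \<tau> ` e \<notin> Y'" unfolding Fix_def eq' by auto
        have "(\<Phi> \<circ> \<tau>) ` e \<notin> Y \<union> (`) \<Phi> ` Y'" if "e \<in> X \<union> X'" for e
        proof (cases "e \<in> X'")
          case True
          hence e: "e \<in> E" using X' by auto
          have "\<tau> ` e \<subseteq> W \<union> N" using e \<tau>(1) by (auto simp: memE bij_betw_def)
          moreover have "inj_on \<tau> e"
            using e \<tau>(1) by (auto simp: memE bij_betw_def intro: inj_on_subset)
          hence "card (\<tau> ` e) = k" using e by (simp add: memE card_image)
          moreover have "\<tau> ` e \<inter> N \<noteq> {}" using e \<tau>(3) by (auto simp: memE)
          ultimately have "\<tau> ` e \<in> E" using e by (simp add: memE)
          hence "\<Phi> ` \<tau> ` e \<in> E" "\<Phi> ` \<tau> ` e \<notin> (`) \<Phi> ` Y'"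
            using img inj_on_image_mem_iff[OF inj_img, of "\<tau> ` e" Y'] Y' avoid[OF True] by auto
          thus ?thesis using Y split(2) by (auto simp: image_comp)
        next
          case False
          hence eX: "e \<in> X" using that by simp
          hence eW: "e \<subseteq> W" using X by (auto simp: nsets_def)
          hence "(\<Phi> \<circ> \<tau>) ` e = \<phi> ` e" using \<tau>(2) by (intro image_cong) (auto simp: \<Phi>_def)
          moreover have "\<phi> ` e \<subseteq> W" using eW \<phi>(1) by (auto simp: bij_betw_def)
          hence "\<phi> ` e \<notin> E" using WN by (auto simp: memE)
          hence "\<phi> ` e \<notin> (`) \<Phi> ` Y'" using img Y' by blast
          ultimately show ?thesis using \<phi>(2)[OF eX] by simp
        qed
        moreover have "bij_betw (\<Phi> \<circ> \<tau>) (W \<union> N) (W \<union> N)" by (rule bij_betw_trans[OF \<tau>(1) \<Phi>])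
        ultimately show False using XY'(2) unfolding eq' Fail_def by blast
      qed
    qed
    also have "\<dots> \<le> \<gamma>" using \<gamma> unfolding E_def Fix_def .
    finally show "measure_pmf.prob (pair_pmf (random_subset E p) (random_subset E q))
        {XY'. (XY, XY') \<in> {((X, Y), (X', Y')). (X \<union> X', Y \<union> Y') \<in> Fail}} \<le> \<gamma>" .
  qed
  finally show ?thesis unfolding prob_unpackable_def .
qed

section \<open>Choice of the parameters\<close>

text \<open>
  All parameters are powers of \<open>t\<close>, up to a factor \<open>k\<close>, and this collects how large \<open>t\<close> has to be. As
  \<open>n\<close> will lie between \<open>t ^ (100 * k)\<close> and \<open>t ^ (200 * k)\<close>, the right hand sides of the first two long
  inequalities are at most \<open>1 / (n * t)\<close> and \<open>1 / n\<^sup>2\<close>. The number \<open>140\<close> is the allowance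
  \<open>c * j\<close> with \<open>c = 7\<close> and \<open>j = 20\<close> in the definition of \<open>scattered\<close>.
\<close>

definition large :: "nat \<Rightarrow> real \<Rightarrow> nat \<Rightarrow> bool" where
  "large k \<delta> t \<longleftrightarrow> k \<le> t \<and> 13 \<le> t \<and> 100 * real k * ln (real t + 1) \<le> t \<and>
     t ^ 4 * (t ^ 4 * ((real t ^ 4) ^ (t\<^sup>2 + 140) * (1 - 1 / t) ^ (t ^ 4 - (t\<^sup>2 + 140)))) \<le> 1 / real t ^ (200 * k + 1) \<and>
     (real t ^ 2) ^ 140 * (1 - 1 / t) ^ (t\<^sup>2 - 140) \<le> 1 / real t ^ (400 * k) \<and>
     real t ^ 14 * (1 - \<delta>) ^ (t - 1) \<le> 1"

lemma one_minus_power_le_exp: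
  fixes x :: real
  assumes "x \<le> 1"
  shows "(1 - x) ^ a \<le> exp (- (a * x))"
proof -
  have "(1 - x) ^ a \<le> exp (- x) ^ a"
    using assms exp_ge_add_one_self[of "- x"] by (intro power_mono) auto
  thus ?thesis by (simp add: exp_of_nat_mult[symmetric])
qed

text \<open>
  The powers \<open>(1 - 1 / t) ^ (t ^ 4)\<close> and \<open>(1 - 1 / t) ^ t\<^sup>2\<close> are about
  \<open>exp (- t ^ 3)\<close> and \<open>exp (- t)\<close>, and beat \<open>t\<close> to the power \<open>4 * t\<^sup>2\<close> and any fixed power of \<open>t\<close>,
  respectively.
\<close>

lemma eventually_large:
  assumes \<delta>: "0 < \<delta>" "\<delta> < 1"
  shows "\<forall>\<^sub>F t in sequentially. large k \<delta> t"
proof -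
  have pw: "real t ^ a = exp (a * ln t)" if "13 \<le> t" for t a :: nat
    using that by (simp add: exp_of_nat_mult)
  have "\<forall>\<^sub>F x in at_top. 100 * real k * ln (x + 1) \<le> (x :: real)"
    by real_asymp
  hence 1: "\<forall>\<^sub>F t in sequentially. 100 * real k * ln (real t + 1) \<le> t"
    by (rule eventually_compose_filterlim[OF _ filterlim_real_sequentially])
  have "\<forall>\<^sub>F x in at_top. (8 + 4 * (x\<^sup>2 + 140)) * ln x - (x ^ 4 - (x\<^sup>2 + 140)) / x \<le> - ((200 * real k + 1) * ln x)"
    by real_asymp
  hence 2: "\<forall>\<^sub>F t in sequentially. (8 + 4 * ((real t)\<^sup>2 + 140)) * ln t - (real t ^ 4 - ((real t)\<^sup>2 + 140)) / t
      \<le> - ((200 * real k + 1) * ln t)"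
    by (rule eventually_compose_filterlim[OF _ filterlim_real_sequentially])
  have "\<forall>\<^sub>F x in at_top. 280 * ln x - (x\<^sup>2 - 140) / x \<le> - (400 * real k * ln x)"
    by real_asymp
  hence 3: "\<forall>\<^sub>F t in sequentially. 280 * ln t - ((real t)\<^sup>2 - 140) / t \<le> - (400 * real k * ln t)"
    by (rule eventually_compose_filterlim[OF _ filterlim_real_sequentially])
  have "\<forall>\<^sub>F x in at_top. 14 * ln x - (x - 1) * \<delta> \<le> 0"
    using \<delta> by real_asymp
  hence 4: "\<forall>\<^sub>F t in sequentially. 14 * ln t - (real t - 1) * \<delta> \<le> 0"
    by (rule eventually_compose_filterlim[OF _ filterlim_real_sequentially])
  show ?thesis
    using 1 2 3 4 eventually_ge_at_top[of k] eventually_ge_at_top[of 13]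
  proof eventually_elim
    case (elim t)
    have t13: "13 \<le> t" by fact
    have sq: "140 \<le> t\<^sup>2" using power_mono[OF t13, of 2] by simp
    have qd: "t\<^sup>2 + 140 \<le> t ^ 4"
    proof -
      have "t\<^sup>2 + 140 \<le> 2 * t\<^sup>2" using sq by simp
      also have "\<dots> \<le> t\<^sup>2 * t\<^sup>2" using sq by (intro mult_right_mono) auto
      also have "\<dots> = t ^ 4" by (simp flip: power_add)
      finally show ?thesis .
    qed
    have x: "1 / real t \<le> 1" using t13 by simp
    have 2: "t ^ 4 * (t ^ 4 * ((real t ^ 4) ^ (t\<^sup>2 + 140) * (1 - 1 / t) ^ (t ^ 4 - (t\<^sup>2 + 140)))) \<le> 1 / real t ^ (200 * k + 1)"
    proof -
      have "(1 - 1 / real t) ^ (t ^ 4 - (t\<^sup>2 + 140)) \<le> exp (- ((t ^ 4 - (t\<^sup>2 + 140)) * (1 / t)))"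
        using one_minus_power_le_exp[OF x, of "t ^ 4 - (t\<^sup>2 + 140)"] qd by (simp add: of_nat_diff)
      hence "t ^ 4 * (t ^ 4 * ((real t ^ 4) ^ (t\<^sup>2 + 140) * (1 - 1 / t) ^ (t ^ 4 - (t\<^sup>2 + 140))))
          \<le> real t ^ 4 * (real t ^ 4 * ((real t ^ 4) ^ (t\<^sup>2 + 140) * exp (- ((t ^ 4 - (t\<^sup>2 + 140)) * (1 / t)))))"
        by (simp add: mult_left_mono)
      also have "\<dots> = real t ^ (8 + 4 * (t\<^sup>2 + 140)) * exp (- ((t ^ 4 - (t\<^sup>2 + 140)) * (1 / t)))"
        by (simp add: power_add power_mult)
      also have "\<dots> = exp ((8 + 4 * ((real t)\<^sup>2 + 140)) * ln t - (real t ^ 4 - ((real t)\<^sup>2 + 140)) / t)"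
        unfolding pw[OF t13, of "8 + 4 * (t\<^sup>2 + 140)"] exp_add[symmetric] using qd by (simp add: of_nat_diff)
      also have "\<dots> \<le> exp (- ((200 * real k + 1) * ln t))" using elim(2) by simp
      also have "\<dots> = 1 / real t ^ (200 * k + 1)" unfolding pw[OF t13] by (simp add: exp_minus inverse_eq_divide)
      finally show ?thesis .
    qed
    have 3: "(real t ^ 2) ^ 140 * (1 - 1 / t) ^ (t\<^sup>2 - 140) \<le> 1 / real t ^ (400 * k)"
    proof -
      have "(1 - 1 / real t) ^ (t\<^sup>2 - 140) \<le> exp (- ((t\<^sup>2 - 140) * (1 / t)))"
        using one_minus_power_le_exp[OF x, of "t\<^sup>2 - 140"] sq by (simp add: of_nat_diff)
      hence "(real t ^ 2) ^ 140 * (1 - 1 / t) ^ (t\<^sup>2 - 140) \<le> (real t ^ 2) ^ 140 * exp (- ((t\<^sup>2 - 140) * (1 / t)))"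
        by (simp add: mult_left_mono)
      also have "\<dots> = real t ^ 280 * exp (- ((t\<^sup>2 - 140) * (1 / t)))"
        by (simp add: power_mult[symmetric])
      also have "\<dots> = exp (280 * ln t - ((real t)\<^sup>2 - 140) / t)"
        unfolding pw[OF t13, of 280] exp_add[symmetric] using sq by (simp add: of_nat_diff)
      also have "\<dots> \<le> exp (- (400 * real k * ln t))" using elim(3) by simp
      also have "\<dots> = 1 / real t ^ (400 * k)" unfolding pw[OF t13] by (simp add: exp_minus inverse_eq_divide)
      finally show ?thesis .
    qed
    have 4: "real t ^ 14 * (1 - \<delta>) ^ (t - 1) \<le> 1"
    proof -
      have "(1 - \<delta>) ^ (t - 1) \<le> exp (- ((real t - 1) * \<delta>))"
        using one_minus_power_le_exp[of \<delta> "t - 1"] \<delta> t13 by (simp add: of_nat_diff)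
      hence "real t ^ 14 * (1 - \<delta>) ^ (t - 1) \<le> real t ^ 14 * exp (- ((real t - 1) * \<delta>))"
        by (simp add: mult_left_mono)
      also have "\<dots> = exp (14 * ln t - (real t - 1) * \<delta>)"
        unfolding pw[OF t13, of 14] exp_add[symmetric] by simp
      also have "\<dots> \<le> 1" using elim(4) by simp
      finally show ?thesis .
    qed
    show ?case using elim(1,5) t13 2 3 4 by (simp add: large_def)
  qed
qed

lemma ex_power_bracket:
  fixes n K :: nat
  assumes "0 < K"
  shows "\<exists>t. t ^ K \<le> n \<and> n < (t + 1) ^ K"
proof -
  define t where "t = (LEAST t. n < (t + 1) ^ K)"
  have "n < (n + 1) ^ K" using self_le_power[of "n + 1" K] assms by simp
  hence "n < (t + 1) ^ K" unfolding t_def by (rule LeastI)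
  moreover have "t ^ K \<le> n"
  proof (cases t)
    case (Suc u)
    hence "\<not> n < (u + 1) ^ K" using not_less_Least[of u "\<lambda>t. n < (t + 1) ^ K"] by (simp add: t_def)
    thus ?thesis using Suc by simp
  qed (use assms in \<open>simp add: zero_power\<close>)
  ultimately show ?thesis by blast
qed

lemma ln_le_if_large:
  assumes "large k \<delta> t" "n < (t + 1) ^ (100 * k)" "0 < n"
  shows "ln (real n) \<le> t"
proof -
  have "real n \<le> (real t + 1) ^ (100 * k)"
    using assms(2) by (metis less_imp_le of_nat_1 of_nat_add of_nat_le_iff of_nat_power)
  hence "ln (real n) \<le> ln ((real t + 1) ^ (100 * k))" using assms(3) by simp
  also have "\<dots> = 100 * real k * ln (real t + 1)" by (simp add: ln_realpow)
  finally show ?thesis using assms(1) by (simp add: large_def)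
qed

text \<open>
  The inverse of a packing is a packing in the other direction; this allows assuming \<open>p \<le> q\<close>.
\<close>

lemma prob_unpackable_commute:
  assumes "finite V"
  shows "prob_unpackable V k p q \<le> prob_unpackable V k q p"
proof -
  have "prob_unpackable V k p q = measure_pmf.prob (pair_pmf (random_subset (nsets V k) q) (random_subset (nsets V k) p))
      {(Y, X). \<not> (\<exists>\<phi>. bij_betw \<phi> V V \<and> (\<forall>e\<in>X. \<phi> ` e \<notin> Y))}"
    unfolding prob_unpackable_def
    by (subst pair_commute_pmf) (simp add: vimage_def case_prod_unfold)
  also have "\<dots> \<le> prob_unpackable V k q p"
    unfolding prob_unpackable_def
  proof (rule prob_le_if)
    fix YX assume YX: "YX \<in> set_pmf (pair_pmf (random_subset (nsets V k) q) (random_subset (nsets V k) p))"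
      "YX \<in> {(Y, X). \<not> (\<exists>\<phi>. bij_betw \<phi> V V \<and> (\<forall>e\<in>X. \<phi> ` e \<notin> Y))}"
    obtain X Y where eq: "YX = (Y, X)" by (cases YX)
    have X: "X \<subseteq> nsets V k" and Y: "Y \<subseteq> nsets V k" using YX(1) eq by (auto dest: set_pmf_random_subset)
    have "\<not> (bij_betw \<phi> V V \<and> (\<forall>e\<in>Y. \<phi> ` e \<notin> X))" for \<phi>
    proof
      assume \<phi>: "bij_betw \<phi> V V \<and> (\<forall>e\<in>Y. \<phi> ` e \<notin> X)"
      have "inv_into V \<phi> ` e \<notin> Y" if "e \<in> X" for e
      proof
        assume "inv_into V \<phi> ` e \<in> Y"
        moreover have "\<phi> ` (inv_into V \<phi> ` e) = e"
          using that X \<phi> by (intro image_inv_into_cancel) (auto simp: bij_betw_def nsets_def)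
        ultimately show False using \<phi> that by metis
      qed
      thus False using YX(2) eq \<phi> bij_betw_inv_into[of \<phi> V V] by auto
    qed
    thus "YX \<in> {(X, Y). \<not> (\<exists>\<phi>. bij_betw \<phi> V V \<and> (\<forall>e\<in>X. \<phi> ` e \<notin> Y))}" using eq by simp
  qed
  finally show ?thesis .
qed

text \<open>
  First moment bound for the identity. It is good enough for a starting set of fewer vertices than a block.
\<close>

lemma prob_unpackable_le_expected_conflicts:
  fixes p q :: real
  assumes "0 \<le> p" "p \<le> 1" "0 \<le> q" "q \<le> 1" "finite V"
  shows "prob_unpackable V k p q \<le> real (card V) ^ k * (p * q)"
proof -
  have fin: "finite (nsets V k)" using assms by (intro finite_imp_finite_nsets)
  have "prob_unpackable V k p q \<le> card (nsets V k) * (p * q)"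
    unfolding prob_unpackable_def
  proof (rule prob_union_bound_card[OF fin, where Q = "\<lambda>e. {(X, Y). {e} \<subseteq> X \<and> {e} \<subseteq> Y}"])
    fix XY assume XY: "XY \<in> set_pmf (pair_pmf (random_subset (nsets V k) p) (random_subset (nsets V k) q))"
      "XY \<in> {(X, Y). \<not> (\<exists>\<phi>. bij_betw \<phi> V V \<and> (\<forall>e\<in>X. \<phi> ` e \<notin> Y))}"
    obtain X Y where eq: "XY = (X, Y)" by (cases XY)
    have "X \<subseteq> nsets V k" using XY(1) eq by (auto dest: set_pmf_random_subset)
    moreover have "\<exists>e\<in>X. (\<lambda>v. v) ` e \<in> Y"
      using XY(2) eq bij_betw_id[of V] by (auto simp: id_def simp del: image_ident)
    ultimately show "\<exists>e\<in>nsets V k. XY \<in> {(X, Y). {e} \<subseteq> X \<and> {e} \<subseteq> Y}" using eq by auto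
  next
    fix e assume "e \<in> nsets V k"
    thus "measure_pmf.prob (pair_pmf (random_subset (nsets V k) p) (random_subset (nsets V k) q))
        {(X, Y). {e} \<subseteq> X \<and> {e} \<subseteq> Y} \<le> p * q"
      using prob_pair_random_subset_superset[OF assms(1-4) fin fin, of "{e}" "{e}"] by simp
  qed
  also have "card (nsets V k) = card V choose k"
    using card_nsets[of V k] by simp
  also have "real (card V choose k) * (p * q) \<le> real (card V ^ k) * (p * q)"
    using assms by (intro mult_right_mono of_nat_mono binomial_le_power) simp
  finally show ?thesis by simp
qed

text \<open>
  The subblocks have size \<open>m = t ^ 4\<close>, there are \<open>b = k * t\<close> of them, \<open>T = t\<close> shifts, and sets of size
  \<open>r = t\<^sup>2\<close> have to be joined; the lower bound for the probability that a link is missed is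
  \<open>\<theta> = 1 / t\<close>. The choice of \<open>\<epsilon>\<close> as \<open>\<delta> ^ s / s\<close> makes the moment of order \<open>s\<close> in the Chernoff
  bound at most \<open>n\<close>, while \<open>\<theta> ^ s \<le> 1 / n ^ 3\<close>. With \<open>c = 7\<close> an element in eight links
  is unlikely, as \<open>p\<close> to the power \<open>8\<close> is at most about \<open>n\<close> to the power \<open>-4 * (k - 1)\<close>, and with \<open>j = 20\<close> the
  expected number of \<open>j\<close>-subsets of the overlap in a random set is at most about \<open>n\<close> to the power \<open>-10\<close>. The
  exponentially small terms are covered by \<open>large\<close>. Most of the others have the form \<open>t ^ a / n ^ l\<close> with \<open>l \<ge> 2\<close> and are
  compared with \<open>U = 1 / (n * t)\<close> by \<open>n \<ge> t ^ 200\<close>.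
\<close>

lemma prob_unpackable_add_block_le:
  fixes n k t w :: nat and p q \<delta> :: real
  defines "s \<equiv> 600 * k"
  assumes k: "2 \<le> k" and \<delta>: "0 < \<delta>" "\<delta> < 1" and t: "large k \<delta> t"
    and n: "t ^ (100 * k) \<le> n" "n < (t + 1) ^ (100 * k)"
    and p: "0 < p" "p \<le> q" "q \<le> 1 - \<delta>"
    and pq: "p * q \<le> \<delta> ^ s / s * (ln n / real n ^ (k - 1))"
    and w: "w + (k * t) * t ^ 4 \<le> n"
  shows "prob_unpackable {..<w + (k * t) * t ^ 4} k p q \<le> prob_unpackable {..<w} k p q + 11 / (n * t)"
proof -
  define x where "x = real t"
  define nn where "nn = real n"
  define b where "b = k * t"
  define m where "m = t ^ 4"
  define r where "r = t\<^sup>2"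
  define W where "W = {..<w}"
  define A where "A i = {w + i * m..<w + (i + 1) * m}" for i
  define N where "N = {w..<w + b * m}"
  define M where "M = real (card N)"
  define F where "F = nsets W (k - 1)"
  define f where "f = real (card F)"
  define y where "y = 1 / nn\<^sup>2"
  define U where "U = 1 / (nn * x)"
  from t have kt: "k \<le> t" and t13: "13 \<le> t"
    and e2: "x ^ 4 * (x ^ 4 * ((x ^ 4) ^ (t\<^sup>2 + 140) * (1 - 1 / x) ^ (t ^ 4 - (t\<^sup>2 + 140)))) \<le> 1 / x ^ (200 * k + 1)"
    and e3: "(x ^ 2) ^ 140 * (1 - 1 / x) ^ (t\<^sup>2 - 140) \<le> 1 / x ^ (400 * k)"
    and e4: "x ^ 14 * (1 - \<delta>) ^ (t - 1) \<le> 1"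
    unfolding large_def x_def by auto
  have x13: "13 \<le> x" using t13 by (simp add: x_def)
  have x0: "0 < x" and x1: "1 \<le> x" using x13 by auto
  have nx: "x ^ (100 * k) \<le> nn" and nx1: "nn < (x + 1) ^ (100 * k)"
    using n unfolding nn_def x_def by (metis of_nat_le_iff of_nat_power, metis of_nat_1 of_nat_add of_nat_less_iff of_nat_power)
  have nn200: "x ^ 200 \<le> nn"
    using power_increasing[of 200 "100 * k" x] k x1 nx by linarith
  have nn: "0 < nn" and nn1: "1 \<le> nn" using nn200 one_le_power[OF x1, of 200] by linarith+
  have nU: "nn \<le> x ^ (200 * k)"
  proof -
    have "13 * x \<le> x ^ 2" using x13 by (simp add: power2_eq_square)
    hence "x + 1 \<le> x ^ 2" using x13 by linarith
    hence "(x + 1) ^ (100 * k) \<le> (x ^ 2) ^ (100 * k)" using x0 by (intro power_mono) auto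
    thus ?thesis using nx1 by (simp add: power_mult[symmetric] mult.commute)
  qed
  have lnn: "0 \<le> ln nn" "ln nn \<le> x"
  proof -
    show "0 \<le> ln nn" using nn1 by simp
    show "ln nn \<le> x" using ln_le_if_large[OF t n(2)] nn by (simp add: nn_def x_def)
  qed
  have q: "0 < q" "q < 1" using p \<delta> by auto
  have p1: "0 \<le> p" "p \<le> 1" and q1: "0 \<le> q" "q \<le> 1" using p q by auto
  have s0: "0 < s" using k by (simp add: s_def)
  have \<epsilon>: "0 < \<delta> ^ s / s" "\<delta> ^ s / s \<le> 1"
  proof -
    show "0 < \<delta> ^ s / s" using \<delta> s0 by simp
    have "\<delta> ^ s \<le> 1" using \<delta> by (simp add: power_le_one)
    thus "\<delta> ^ s / s \<le> 1" using s0 by (simp add: divide_le_eq)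
  qed
  \<comment> \<open>\<open>L\<close> bounds \<open>p * q\<close> and hence \<open>p\<^sup>2\<close>\<close>
  define L where "L = x / nn ^ (k - 1)"
  have L: "p * q \<le> L"
  proof -
    have "p * q \<le> \<delta> ^ s / s * (ln nn / nn ^ (k - 1))" using pq by (simp add: nn_def)
    also have "\<dots> \<le> 1 * (x / nn ^ (k - 1))"
      using \<epsilon> lnn nn by (intro mult_mono divide_right_mono) auto
    finally show ?thesis by (simp add: L_def)
  qed
  have pp: "p\<^sup>2 \<le> L"
  proof -
    have "p * p \<le> p * q" using p by (intro mult_left_mono) auto
    thus ?thesis using L by (simp add: power2_eq_square)
  qed
  have nk: "nn \<le> nn ^ (k - 1)" using self_le_power[of nn "k - 1"] nn1 k by simp
  have Ln: "L \<le> x / nn" unfolding L_def using nk nn x0 by (intro divide_left_mono) auto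
  have L0: "0 \<le> L" using x0 nn by (simp add: L_def)
  have cardN: "card N = b * m" by (simp add: N_def)
  have Mx: "M \<le> x ^ 6"
  proof -
    have "M = k * x ^ 5" by (simp add: M_def cardN b_def m_def x_def power_numeral_reduce)
    also have "\<dots> \<le> x * x ^ 5" using kt x0 by (intro mult_right_mono) (auto simp: x_def)
    finally show ?thesis by (simp add: power_numeral_reduce)
  qed
  have M0: "0 \<le> M" by (simp add: M_def)
  have wn: "w \<le> n" using w by simp
  have fle: "f \<le> nn ^ (k - 1)"
  proof -
    have "card F \<le> w ^ (k - 1)" unfolding F_def W_def by (simp add: binomial_le_power)
    also have "\<dots> \<le> n ^ (k - 1)" using wn by (rule power_mono) simp
    finally show ?thesis unfolding f_def nn_def by (metis of_nat_le_iff of_nat_power)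
  qed
  have f0: "0 \<le> f" by (simp add: f_def)
  \<comment> \<open>absorbs an error term of the form \<open>t ^ a / n ^ l\<close>\<close>
  have U_I: "z \<le> c * U" if "z \<le> c * x ^ a / nn ^ l" "a + 1 \<le> 200 * (l - 1)" "2 \<le> l" "0 \<le> c" for z c :: real and a l :: nat
  proof -
    have "x ^ a * x \<le> x ^ (200 * (l - 1))"
      using that(2) power_increasing[of "a + 1" "200 * (l - 1)" x] x1 by (simp add: mult.commute)
    also have "\<dots> \<le> nn ^ (l - 1)" unfolding power_mult using nn200 x0 by (intro power_mono) auto
    finally have "x ^ a * x * nn \<le> nn ^ (l - 1) * nn" using nn by simp
    also have "nn ^ (l - 1) * nn = nn ^ l" using that(3) by (cases l) auto
    finally have "x ^ a / nn ^ l \<le> U" unfolding U_def using nn x0 by (simp add: field_simps)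
    hence "c * (x ^ a / nn ^ l) \<le> c * U" using that(4) by (rule mult_left_mono)
    thus ?thesis using that(1) by simp
  qed
  have U0: "0 < U" using nn x0 by (simp add: U_def)
  define \<theta> where "\<theta> = 1 / x"
  have \<theta>: "0 \<le> \<theta>" "\<theta> \<le> 1" "0 < \<theta>" using x1 by (auto simp: \<theta>_def)
  have y0: "0 < y" using nn by (simp add: y_def)
  have \<eta>: "measure_pmf.prob (random_subset (N \<times> F) p) {D. \<not> scattered N F q \<theta> 7 20 y D} \<le> 3 * U"
  proof -
    have 1: "M * (\<theta> ^ s * (1 + p * (1 / (1 - q) ^ s - 1)) ^ card F) \<le> 1 * U"
    proof (rule U_I[where a = 6 and l = 2])
      have q\<delta>: "\<delta> ^ s \<le> (1 - q) ^ s" using p \<delta> by (intro power_mono) auto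
      have "1 - s * q \<le> (1 - q) ^ s" using Bernoulli_inequality[of "- q" s] q by simp
      hence "(1 / (1 - q) ^ s - 1) * (1 - q) ^ s \<le> s * q" using q by (simp add: left_diff_distrib)
      hence "1 / (1 - q) ^ s - 1 \<le> s * q / (1 - q) ^ s" using q by (simp add: pos_le_divide_eq)
      also have "\<dots> \<le> s * q / \<delta> ^ s" using q\<delta> \<delta> q by (intro divide_left_mono) auto
      finally have "p * (1 / (1 - q) ^ s - 1) \<le> p * (s * q / \<delta> ^ s)" using p by (intro mult_left_mono) auto
      also have "\<dots> = (p * q) * (s / \<delta> ^ s)" by simp
      also have "\<dots> \<le> (\<delta> ^ s / s * (ln nn / nn ^ (k - 1))) * (s / \<delta> ^ s)"
        using pq \<delta> by (intro mult_right_mono) (auto simp: nn_def)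
      also have "\<dots> = ln nn / nn ^ (k - 1)" using \<delta> s0 by simp
      finally have z: "p * (1 / (1 - q) ^ s - 1) \<le> ln nn / nn ^ (k - 1)" .
      have z0: "0 \<le> p * (1 / (1 - q) ^ s - 1)"
        using p q by (intro mult_nonneg_nonneg) (auto simp: le_divide_eq power_le_one)
      have "1 + p * (1 / (1 - q) ^ s - 1) \<le> exp (ln nn / nn ^ (k - 1))"
        by (rule order_trans[OF _ exp_ge_add_one_self]) (use z in linarith)
      hence "(1 + p * (1 / (1 - q) ^ s - 1)) ^ card F \<le> exp (ln nn / nn ^ (k - 1)) ^ card F"
        using z0 by (rule power_mono[OF _ add_nonneg_nonneg[OF zero_le_one]])
      also have "\<dots> = exp (f * (ln nn / nn ^ (k - 1)))" by (simp add: f_def exp_of_nat_mult[symmetric])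
      also have "\<dots> \<le> exp (nn ^ (k - 1) * (ln nn / nn ^ (k - 1)))"
        using fle lnn nn by (simp del: times_divide_eq_right add: mult_right_mono)
      also have "\<dots> = nn" using nn by simp
      finally have E: "(1 + p * (1 / (1 - q) ^ s - 1)) ^ card F \<le> nn" .
      have "nn ^ 3 \<le> (x ^ (200 * k)) ^ 3" using nU nn by (intro power_mono) auto
      also have "\<dots> = x ^ s" by (simp add: s_def power_mult[symmetric])
      finally have "\<theta> ^ s \<le> 1 / nn ^ 3"
        unfolding \<theta>_def power_one_over using nn x0 by (intro divide_left_mono) auto
      hence "M * (\<theta> ^ s * (1 + p * (1 / (1 - q) ^ s - 1)) ^ card F) \<le> x ^ 6 * (1 / nn ^ 3 * nn)"
        using E Mx z0 x0 \<theta> M0 nn by (intro mult_mono) auto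
      also have "\<dots> = 1 * x ^ 6 / nn ^ 2" using nn by (simp add: power2_eq_square power3_eq_cube)
      finally show "M * (\<theta> ^ s * (1 + p * (1 / (1 - q) ^ s - 1)) ^ card F) \<le> 1 * x ^ 6 / nn ^ 2" .
    qed auto
    have 2: "f * (M * p) ^ Suc 7 \<le> 1 * U"
    proof (rule U_I[where a = 52 and l = 3])
      have "p ^ 8 = (p\<^sup>2) ^ 4" by simp
      also have "\<dots> \<le> L ^ 4" using pp by (intro power_mono) auto
      finally have p8: "p ^ 8 \<le> L ^ 4" .
      have "M ^ 8 \<le> (x ^ 6) ^ 8" using Mx M0 by (rule power_mono)
      hence "M ^ 8 * p ^ 8 \<le> (x ^ 6) ^ 8 * L ^ 4" using p8 p1 x0 by (intro mult_mono) auto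
      from mult_mono[OF fle this] have "f * (M ^ 8 * p ^ 8) \<le> nn ^ (k - 1) * ((x ^ 6) ^ 8 * L ^ 4)"
        using M0 p1 nn by simp
      hence "f * (M * p) ^ Suc 7 \<le> nn ^ (k - 1) * ((x ^ 6) ^ 8 * L ^ 4)"
        by (simp add: power_mult_distrib)
      also have "\<dots> = x ^ 52 / (nn ^ (k - 1)) ^ 3" using nn by (simp add: L_def field_simps power_numeral_reduce)
      also have "\<dots> \<le> x ^ 52 / nn ^ 3" using nk nn x0 by (intro divide_left_mono power_mono) auto
      finally show "f * (M * p) ^ Suc 7 \<le> 1 * x ^ 52 / nn ^ 3" by simp
    qed auto
    have 3: "(f * ((M * p)\<^sup>2 * q)) ^ 20 / y \<le> 1 * U"
    proof (rule U_I[where a = 270 and l = 8])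
      have "f * ((M * p)\<^sup>2 * q) = f * (M\<^sup>2 * (p * q)) * p" by (simp add: power2_eq_square)
      also have "\<dots> \<le> nn ^ (k - 1) * ((x ^ 6)\<^sup>2 * L) * p"
      proof (rule mult_right_mono)
        have "M\<^sup>2 \<le> (x ^ 6)\<^sup>2" using Mx M0 by (rule power_mono)
        from mult_mono[OF this L] have "M\<^sup>2 * (p * q) \<le> (x ^ 6)\<^sup>2 * L" using p1 q1 by simp
        from mult_mono[OF fle this] show "f * (M\<^sup>2 * (p * q)) \<le> nn ^ (k - 1) * ((x ^ 6)\<^sup>2 * L)"
          using p1 q1 nn by simp
      qed (use p1 in simp)
      also have "nn ^ (k - 1) * ((x ^ 6)\<^sup>2 * L) = x ^ 13" using nn by (simp add: L_def power_numeral_reduce)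
      finally have "(f * ((M * p)\<^sup>2 * q)) ^ 20 \<le> (x ^ 13 * p) ^ 20"
        using f0 q1 by (intro power_mono) auto
      also have "\<dots> = x ^ 260 * (p\<^sup>2) ^ 10" by (simp add: power_mult_distrib power_mult[symmetric])
      also have "\<dots> \<le> x ^ 260 * (x / nn) ^ 10" using pp Ln x0 by (intro mult_left_mono power_mono) auto
      also have "\<dots> = x ^ 270 / nn ^ 10" by (simp add: power_divide power_add[symmetric])
      finally have "(f * ((M * p)\<^sup>2 * q)) ^ 20 / y \<le> x ^ 270 / nn ^ 10 / y"
        using y0 by (intro divide_right_mono) auto
      also have "\<dots> = 1 * x ^ 270 / nn ^ 8" using nn by (simp add: y_def field_simps power_numeral_reduce)
      finally show "(f * ((M * p)\<^sup>2 * q)) ^ 20 / y \<le> 1 * x ^ 270 / nn ^ 8" .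
    qed auto
    have "measure_pmf.prob (random_subset (N \<times> F) p) {D. \<not> scattered N F q \<theta> 7 20 y D}
        \<le> M * (\<theta> ^ s * (1 + p * (1 / (1 - q) ^ s - 1)) ^ card F)
          + f * (M * p) ^ Suc 7 + (f * ((M * p)\<^sup>2 * q)) ^ 20 / y"
      unfolding M_def f_def F_def W_def N_def
      by (rule prob_not_scattered_le[OF p1 q1(1) q(2) _ _ \<theta>(3) y0]) (auto intro: finite_imp_finite_nsets)
    thus ?thesis using 1 2 3 by linarith
  qed
  define \<beta> where "\<beta> = real m * (real m ^ r * (1 - \<theta>) ^ (m - r))
        + real m * (y + real m ^ (r + 7 * 20) * (1 - \<theta>) ^ (m - (r + 7 * 20)))
        + real m ^ (2 * r) * (y + real r ^ (7 * 20) * (1 - \<theta>) ^ (r - 7 * 20)) ^ r"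
  have r140: "140 \<le> r" using power_mono[OF t13, of 2] by (simp add: r_def)
  have rm: "r + 140 \<le> m"
  proof -
    have "r + 140 \<le> 2 * r" using r140 by simp
    also have "\<dots> \<le> r * r" using r140 by (intro mult_right_mono) auto
    also have "\<dots> = m" by (simp add: r_def m_def flip: power_add)
    finally show ?thesis .
  qed
  have mx: "real m = x ^ 4" "real r = x ^ 2" by (simp_all add: m_def r_def x_def)
  have b4: "(real b)\<^sup>2 \<le> x ^ 4"
  proof -
    have "real b \<le> x * x" using kt by (simp add: b_def x_def mult_right_mono)
    hence "(real b)\<^sup>2 \<le> (x * x)\<^sup>2" by (intro power_mono) auto
    thus ?thesis by (simp add: power_numeral_reduce)
  qed
  have \<beta>: "(real b)\<^sup>2 * \<beta> \<le> 5 * U"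
  proof -
    define G where "G = (x ^ 4) ^ (r + 140) * (1 - 1 / x) ^ (m - (r + 140))"
    have G: "x ^ 4 * (x ^ 4 * G) \<le> U"
    proof -
      have "x ^ 4 * (x ^ 4 * G) \<le> 1 / x ^ (200 * k + 1)" using e2 by (simp add: G_def r_def m_def)
      also have "\<dots> \<le> U" unfolding U_def using nU nn x0 by (intro divide_left_mono) (auto simp: mult.commute)
      finally show ?thesis .
    qed
    \<comment> \<open>\<open>G\<close> also dominates the degree condition without the allowance of \<open>140\<close>\<close>
    have first: "(x ^ 4) ^ r * (1 - 1 / x) ^ (m - r) \<le> G"
      unfolding G_def using x1 by (intro mult_mono power_increasing power_decreasing) auto
    have yy: "x ^ 4 * (x ^ 4 * y) \<le> 1 * U"
      by (rule U_I[where a = 8 and l = 2]) (use nn in \<open>simp_all add: y_def\<close>)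
    have third: "x ^ 4 * ((x ^ 4) ^ (2 * r) * (y + (x ^ 2) ^ 140 * (1 - 1 / x) ^ (r - 140)) ^ r) \<le> 2 * U"
    proof -
      define \<rho> where "\<rho> = y + (x ^ 2) ^ 140 * (1 - 1 / x) ^ (r - 140)"
      have \<rho>0: "0 \<le> \<rho>" using y0 x1 by (simp add: \<rho>_def)
      have "nn\<^sup>2 \<le> (x ^ (200 * k))\<^sup>2" using nU nn by (intro power_mono) auto
      also have "\<dots> = x ^ (400 * k)" by (simp add: power_mult[symmetric] mult.commute)
      finally have "1 / x ^ (400 * k) \<le> y" unfolding y_def using nn x0 by (intro divide_left_mono) auto
      hence \<rho>: "\<rho> \<le> 2 * y" using e3 by (simp add: \<rho>_def r_def)
      have "(x ^ 4)\<^sup>2 * \<rho> \<le> x ^ 8 * (2 * y)" using \<rho> by (simp add: mult_left_mono power_mult[symmetric])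
      also have "\<dots> \<le> 1"
      proof -
        have "x ^ 8 * (2 * y) \<le> 2 * U"
          by (rule U_I[where a = 8 and l = 2]) (use nn in \<open>simp_all add: y_def mult.commute\<close>)
        also have "2 * U \<le> 1"
        proof -
          have "2 * 1 \<le> x * nn" using x13 nn1 by (intro mult_mono) auto
          thus ?thesis using nn x0 by (simp add: U_def divide_le_eq mult.commute)
        qed
        finally show ?thesis .
      qed
      finally have le1: "(x ^ 4)\<^sup>2 * \<rho> \<le> 1" .
      have "(x ^ 4) ^ (2 * r) * \<rho> ^ r = ((x ^ 4)\<^sup>2 * \<rho>) ^ r" by (simp add: power_mult_distrib power_mult)
      also have "\<dots> \<le> ((x ^ 4)\<^sup>2 * \<rho>) ^ 1"
        using le1 \<rho>0 r140 by (intro power_decreasing) auto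
      also have "\<dots> \<le> x ^ 8 * (2 * y)" using \<rho> by (simp add: mult_left_mono power_mult[symmetric])
      finally have "x ^ 4 * ((x ^ 4) ^ (2 * r) * \<rho> ^ r) \<le> x ^ 4 * (x ^ 8 * (2 * y))"
        using x0 by (intro mult_left_mono) auto
      also have "\<dots> \<le> 2 * U"
        by (rule U_I[where a = 12 and l = 2]) (use nn in \<open>simp_all add: y_def mult.commute mult.left_commute power_numeral_reduce\<close>)
      finally show ?thesis by (simp add: \<rho>_def)
    qed
    have \<beta>eq: "\<beta> = x ^ 4 * ((x ^ 4) ^ r * (1 - 1 / x) ^ (m - r)) + x ^ 4 * (y + G)
        + (x ^ 4) ^ (2 * r) * (y + (x ^ 2) ^ 140 * (1 - 1 / x) ^ (r - 140)) ^ r"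
      by (simp add: \<beta>_def G_def mx \<theta>_def)
    have "0 \<le> \<beta>" unfolding \<beta>_def using \<theta> y0 by simp
    hence "(real b)\<^sup>2 * \<beta> \<le> x ^ 4 * \<beta>" using b4 by (intro mult_right_mono) auto
    also have "\<dots> = x ^ 4 * (x ^ 4 * ((x ^ 4) ^ r * (1 - 1 / x) ^ (m - r))) + (x ^ 4 * (x ^ 4 * y) + x ^ 4 * (x ^ 4 * G))
        + x ^ 4 * ((x ^ 4) ^ (2 * r) * (y + (x ^ 2) ^ 140 * (1 - 1 / x) ^ (r - 140)) ^ r)"
      unfolding \<beta>eq by (simp only: distrib_left)
    also have "\<dots> \<le> x ^ 4 * (x ^ 4 * G) + (x ^ 4 * (x ^ 4 * y) + x ^ 4 * (x ^ 4 * G)) + 2 * U"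
      using third first x0 by (intro add_mono mult_left_mono) auto
    also have "\<dots> \<le> 5 * U" using G yy by linarith
    finally show ?thesis .
  qed
  define K where "K = (card N)\<^sup>2 * card (W \<union> N) ^ (k - 2)"
  have K: "real K \<le> x ^ 12 * nn ^ (k - 2)"
  proof -
    have "card (W \<union> N) \<le> n"
    proof -
      have "W \<union> N = {..<w + b * m}" by (auto simp: W_def N_def)
      thus ?thesis using w by (simp add: b_def m_def)
    qed
    hence "real (card (W \<union> N)) \<le> nn" by (simp add: nn_def)
    hence "real (card (W \<union> N)) ^ (k - 2) \<le> nn ^ (k - 2)" by (rule power_mono) simp
    from mult_mono[OF power_mono[OF Mx M0, of 2] this]
    have "M\<^sup>2 * real (card (W \<union> N)) ^ (k - 2) \<le> (x ^ 6)\<^sup>2 * nn ^ (k - 2)" by simp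
    thus ?thesis by (simp add: K_def M_def power_mult[symmetric])
  qed
  have nkk: "nn ^ (k - 1) = nn ^ (k - 2) * nn" using k by (simp flip: power_Suc2 add: Suc_diff_Suc numeral_2_eq_2)
  have Kpq: "K * (p * q) \<le> x ^ 13 / nn"
  proof -
    have "K * (p * q) \<le> (x ^ 12 * nn ^ (k - 2)) * L" using K L p1 q1 x0 nn by (intro mult_mono) auto
    also have "\<dots> = x ^ 13 / nn" unfolding L_def nkk using nn by (simp add: power_numeral_reduce)
    finally show ?thesis .
  qed
  have 1: "K * (p * q ^ t) \<le> U"
  proof -
    have "K * (p * q ^ t) = K * (p * q) * q ^ (t - 1)" using t13 by (cases t) auto
    also have "\<dots> \<le> x ^ 13 / nn * (1 - \<delta>) ^ (t - 1)"
      using Kpq p q1 x0 nn by (intro mult_mono power_mono) auto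
    also have "\<dots> = x ^ 14 * (1 - \<delta>) ^ (t - 1) / (nn * x)" using nn x0 by (simp add: power_numeral_reduce)
    also have "\<dots> \<le> 1 / (nn * x)" using e4 nn x0 by (intro divide_right_mono) auto
    finally show ?thesis by (simp add: U_def)
  qed
  have 2: "(real t)\<^sup>2 * ((real K)\<^sup>2 * (p\<^sup>2 * q\<^sup>2)) \<le> 1 * U"
  proof (rule U_I[where a = 28 and l = 2])
    have "(real t)\<^sup>2 * ((real K)\<^sup>2 * (p\<^sup>2 * q\<^sup>2)) = x\<^sup>2 * (K * (p * q))\<^sup>2"
      by (simp add: x_def power_mult_distrib)
    also have "\<dots> \<le> x\<^sup>2 * (x ^ 13 / nn)\<^sup>2"
      using Kpq p1 q1 by (intro mult_left_mono power_mono) auto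
    also have "\<dots> = 1 * x ^ 28 / nn ^ 2" by (simp add: power_divide power_add[symmetric] power_mult[symmetric])
    finally show "(real t)\<^sup>2 * ((real K)\<^sup>2 * (p\<^sup>2 * q\<^sup>2)) \<le> 1 * x ^ 28 / nn ^ 2" .
  qed auto
  have 3: "(real t)\<^sup>2 * (K * (p\<^sup>2 * q)) \<le> U"
  proof -
    \<comment> \<open>only here a saving by a single factor \<open>p\<close> is left, and a crude bound for it suffices\<close>
    have "p\<^sup>2 \<le> x / nn" using pp Ln by simp
    also have "\<dots> \<le> x / x ^ 200" using nn200 x0 nn by (intro divide_left_mono) auto
    also have "\<dots> \<le> (1 / x ^ 16)\<^sup>2"
    proof -
      have "x * x ^ 32 \<le> x ^ 200" using power_increasing[of 33 200 x] x1 by (simp add: power_numeral_reduce)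
      thus ?thesis using x0 by (simp add: power_divide field_simps power_mult[symmetric])
    qed
    finally have px: "p \<le> 1 / x ^ 16" by (rule power2_le_imp_le) (use x0 in simp)
    have "(real t)\<^sup>2 * (K * (p\<^sup>2 * q)) = x\<^sup>2 * (K * (p * q)) * p" by (simp add: x_def power2_eq_square)
    also have "\<dots> \<le> x\<^sup>2 * (x ^ 13 / nn) * (1 / x ^ 16)"
      using Kpq px p1 q1 x0 nn by (intro mult_mono) auto
    also have "\<dots> = U" using nn x0 by (simp add: U_def field_simps power_numeral_reduce)
    finally show ?thesis .
  qed
  have m0: "0 < m" using t13 by (simp add: m_def)
  have NA: "N = (\<Union>i<b. A i)"
  proof (intro set_eqI iffI)
    fix v assume v: "v \<in> N"
    hence "(v - w) div m < b" using m0 by (auto simp: N_def div_less_iff_less_mult)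
    moreover have "v \<in> A ((v - w) div m)"
    proof -
      have "(v - w) div m * m \<le> v - w" "v - w < ((v - w) div m + 1) * m"
        using m0 dividend_less_div_times[of m "v - w"] by (simp_all add: algebra_simps)
      moreover have "w \<le> v" using v by (simp add: N_def)
      ultimately have "w + (v - w) div m * m \<le> v" "v < w + ((v - w) div m + 1) * m" by linarith+
      thus ?thesis unfolding A_def by simp
    qed
    ultimately show "v \<in> (\<Union>i<b. A i)" by blast
  next
    fix v assume "v \<in> (\<Union>i<b. A i)"
    then obtain i where i: "i < b" "v \<in> A i" by auto
    have "(i + 1) * m \<le> b * m" using i by (intro mult_right_mono) auto
    thus "v \<in> N" using i by (auto simp: A_def N_def)
  qed
  have disj: "disjoint_family_on A {..<b}"
  proof -
    have "A i \<inter> A i' = {}" if "i < i'" for i i'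
    proof -
      have "(i + 1) * m \<le> i' * m" using that by (intro mult_right_mono) auto
      thus ?thesis by (auto simp: A_def)
    qed
    thus ?thesis unfolding disjoint_family_on_def by (metis inf_commute linorder_neqE_nat)
  qed
  have WN: "W \<inter> N = {}" "W \<union> N = {..<w + (k * t) * t ^ 4}" by (auto simp: W_def N_def b_def m_def)
  have "measure_pmf.prob (pair_pmf (random_subset (new_edges W N k) p) (random_subset (new_edges W N k) q))
      {(X, Y). \<not> (\<exists>\<tau>. bij_betw \<tau> (W \<union> N) (W \<union> N) \<and> (\<forall>v\<in>W. \<tau> v = v) \<and> \<tau> ` N \<subseteq> N \<and> (\<forall>e\<in>X. \<tau> ` e \<notin> Y))}
    \<le> 3 * U + (real b)\<^sup>2 * \<beta> + (K * (p * q ^ t) + ((real t)\<^sup>2 * ((real K)\<^sup>2 * (p\<^sup>2 * q\<^sup>2)) + (real t)\<^sup>2 * (K * (p\<^sup>2 * q))))"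
  proof (rule prob_no_extension_fixing_old_le[where A = A and m = m and r = r and c = 7 and j = 20 and y = y
        and \<theta> = \<theta>, OF p1 q1 _ _ _ disj NA WN(1) k])
    show "measure_pmf.prob (random_subset (N \<times> nsets W (k - 1)) p)
        {D. \<not> scattered N (nsets W (k - 1)) q \<theta> 7 20 y D} \<le> 3 * U" using \<eta> by (simp only: F_def)
    show "K = (card N)\<^sup>2 * card (W \<union> N) ^ (k - 2)" by (simp add: K_def)
  qed (use r140 rm \<theta> y0 t13 in \<open>auto simp: W_def A_def b_def \<beta>_def algebra_simps\<close>)
  also have "\<dots> \<le> 11 * U" using \<beta> 1 2 3 by linarith
  finally show ?thesis
    using prob_unpackable_extend[OF _ _ WN(1)] unfolding WN(2)
    by (simp add: W_def N_def U_def nn_def x_def)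
qed

text \<open>
  Blocks are added to a set of \<open>n mod M\<close> vertices, where \<open>M\<close> is the size of a block. There are at most
  \<open>n\<close> steps, each costing \<open>11 / (n * t)\<close>.
\<close>

lemma prob_unpackable_le:
  fixes n k t :: nat and p q \<delta> :: real
  defines "s \<equiv> 600 * k"
  assumes k: "2 \<le> k" and \<delta>: "0 < \<delta>" "\<delta> < 1" and t: "large k \<delta> t"
    and n: "t ^ (100 * k) \<le> n" "n < (t + 1) ^ (100 * k)"
    and p: "0 < p" "p \<le> q" "q \<le> 1 - \<delta>"
    and pq: "p * q \<le> \<delta> ^ s / s * (ln n / real n ^ (k - 1))"
  shows "prob_unpackable {..<n} k p q \<le> 12 / t"
proof -
  define M where "M = (k * t) * t ^ 4"
  define w where "w = n mod M"
  have kt: "k \<le> t" and t13: "13 \<le> t" using t by (auto simp: large_def)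
  have M0: "0 < M" using k t13 by (simp add: M_def)
  have n0: "0 < n" using n(1) t13 by (intro less_le_trans[of 0 "t ^ (100 * k)" n]) auto
  have steps: "prob_unpackable {..<w + i * M} k p q \<le> prob_unpackable {..<w} k p q + i * (11 / (n * t))"
    if "w + i * M \<le> n" for i
    using that
  proof (induction i)
    case (Suc i)
    have "prob_unpackable {..<w + i * M + M} k p q \<le> prob_unpackable {..<w + i * M} k p q + 11 / (n * t)"
      unfolding M_def using Suc.prems pq
      by (intro prob_unpackable_add_block_le[OF k \<delta> t n p]) (simp_all add: M_def s_def algebra_simps)
    thus ?case using Suc by (simp add: algebra_simps add_divide_distrib)
  qed simp
  have base: "prob_unpackable {..<w} k p q \<le> 1 / t"
  proof -
    have "\<delta> ^ s / s \<le> 1"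
      using \<delta> k power_le_one[of \<delta> s] by (simp add: s_def divide_le_eq)
    moreover have "0 \<le> ln (real n) / real n ^ (k - 1)" using n0 by simp
    ultimately have "p * q \<le> ln n / real n ^ (k - 1)"
      using pq mult_right_mono[of "\<delta> ^ s / s" 1 "ln (real n) / real n ^ (k - 1)"] by simp
    also have "\<dots> \<le> t / real n ^ (k - 1)"
      using ln_le_if_large[OF t n(2) n0] by (intro divide_right_mono) auto
    also have "\<dots> \<le> t / real n"
      using self_le_power[of "real n" "k - 1"] n0 k by (intro divide_left_mono) auto
    also have "\<dots> \<le> t / real t ^ (100 * k)"
      using n(1) n0 t13 by (intro divide_left_mono) (simp_all flip: of_nat_power)
    finally have le: "p * q \<le> t / real t ^ (100 * k)" .
    have "w < M" unfolding w_def using M0 by simp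
    also have "M \<le> t ^ 6"
      using kt by (simp add: M_def power_numeral_reduce)
    finally have "real w ^ k \<le> (real t ^ 6) ^ k"
      by (intro power_mono) (simp_all flip: of_nat_power)
    from mult_mono[OF this le]
    have "real w ^ k * (p * q) \<le> real t ^ (6 * k) * (t / real t ^ (100 * k))"
      using p by (simp add: power_mult)
    also have "\<dots> \<le> 1 / t"
    proof -
      have "real t ^ (6 * k + 2) \<le> real t ^ (100 * k)"
        using k t13 by (intro power_increasing) auto
      thus ?thesis using t13 by (simp add: field_simps power_add power2_eq_square)
    qed
    finally show ?thesis
      using prob_unpackable_le_expected_conflicts[of p q "{..<w}" k] p \<delta> by simp
  qed
  have "w + (n div M) * M = n" unfolding w_def by simp
  with steps[of "n div M"]
  have "prob_unpackable {..<n} k p q \<le> prob_unpackable {..<w} k p q + real (n div M) * (11 / (n * t))"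
    by (simp only: order_refl simp_thms)
  moreover have "real (n div M) * (11 / (n * t)) \<le> n * (11 / (n * t))"
    by (intro mult_right_mono) (simp_all add: div_le_dividend)
  moreover have "real n * (11 / (n * t)) = 11 / t" using n0 by simp
  ultimately have "prob_unpackable {..<n} k p q \<le> 1 / t + 11 / t"
    using base by linarith
  thus ?thesis by (simp add: add_divide_distrib[symmetric])
qed

section \<open>Packing random hypergraphs\<close>

lemma random_hypergraph_eq:
  "random_hypergraph n k p = map_pmf (Pair {..<n}) (random_subset (nsets {..<n} k) p)"
  unfolding random_hypergraph_def random_subset_def pmf.map_comp o_def ..

lemma prob_can_be_packed:
  "measure_pmf.prob (pair_pmf (random_hypergraph n k p) (random_hypergraph n k q))
     {(G\<^sub>1, G\<^sub>2). can_be_packed G\<^sub>1 G\<^sub>2} = 1 - prob_unpackable {..<n} k p q"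
proof -
  let ?M = "pair_pmf (random_subset (nsets {..<n} k) p) (random_subset (nsets {..<n} k) q)"
  let ?Un = "{(X, Y). \<not> (\<exists>\<phi>. bij_betw \<phi> {..<n} {..<n} \<and> (\<forall>e\<in>X. \<phi> ` e \<notin> Y))}"
  have "measure_pmf.prob (pair_pmf (random_hypergraph n k p) (random_hypergraph n k q))
     {(G\<^sub>1, G\<^sub>2). can_be_packed G\<^sub>1 G\<^sub>2} = measure_pmf.prob ?M (space ?M - ?Un)"
    unfolding random_hypergraph_eq map_pair[symmetric] measure_map_pmf
    by (intro arg_cong[where f = "measure_pmf.prob ?M"] set_eqI)
       (simp add: can_be_packed_def packing_def case_prod_unfold)
  also have "\<dots> = 1 - prob_unpackable {..<n} k p q"
    unfolding prob_unpackable_def by (rule measure_pmf.prob_compl) simp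
  finally show ?thesis .
qed

theorem theorem1:
  fixes \<delta> :: real
  assumes "0 < \<delta>" and "\<delta> < 1"
  shows "\<forall>k::nat. k \<ge> 2 \<longrightarrow>
    (\<exists>\<epsilon>::real. \<epsilon> > 0 \<and>
      (\<forall>p q :: nat \<Rightarrow> real.
        (\<forall>n\<ge>2. 0 < p n \<and> 0 < q n) \<longrightarrow>
        (\<forall>n\<ge>2. max (p n) (q n) \<le> 1 - \<delta>) \<longrightarrow>
        (\<forall>n\<ge>2. p n * q n \<le> \<epsilon> * (ln (real n) / real n ^ (k - 1))) \<longrightarrow>
        (\<lambda>n. measure_pmf.prob
               (pair_pmf (random_hypergraph n k (p n)) (random_hypergraph n k (q n)))
               {(G\<^sub>1, G\<^sub>2). can_be_packed G\<^sub>1 G\<^sub>2}) \<longlonglongrightarrow> 1))"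
proof (intro allI impI)
  fix k :: nat assume k: "2 \<le> k"
  define s where "s = 600 * k"
  show "\<exists>\<epsilon>::real. \<epsilon> > 0 \<and>
      (\<forall>p q :: nat \<Rightarrow> real.
        (\<forall>n\<ge>2. 0 < p n \<and> 0 < q n) \<longrightarrow>
        (\<forall>n\<ge>2. max (p n) (q n) \<le> 1 - \<delta>) \<longrightarrow>
        (\<forall>n\<ge>2. p n * q n \<le> \<epsilon> * (ln (real n) / real n ^ (k - 1))) \<longrightarrow>
        (\<lambda>n. measure_pmf.prob
               (pair_pmf (random_hypergraph n k (p n)) (random_hypergraph n k (q n)))
               {(G\<^sub>1, G\<^sub>2). can_be_packed G\<^sub>1 G\<^sub>2}) \<longlonglongrightarrow> 1)"
  proof (intro exI[of _ "\<delta> ^ s / s"] conjI allI impI)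
    show "0 < \<delta> ^ s / real s" using assms k by (simp add: s_def)
    fix p q :: "nat \<Rightarrow> real"
    assume pos: "\<forall>n\<ge>2. 0 < p n \<and> 0 < q n" and le: "\<forall>n\<ge>2. max (p n) (q n) \<le> 1 - \<delta>"
      and pq: "\<forall>n\<ge>2. p n * q n \<le> \<delta> ^ s / real s * (ln (real n) / real n ^ (k - 1))"
    have "(\<lambda>n. 1 - prob_unpackable {..<n} k (p n) (q n)) \<longlonglongrightarrow> 1"
    proof (rule LIMSEQ_I)
      fix e :: real assume e: "0 < e"
      obtain t\<^sub>0 where t0: "\<And>t. t\<^sub>0 \<le> t \<Longrightarrow> large k \<delta> t"
        using eventually_large[OF assms, of k] unfolding eventually_sequentially by blast
      obtain B where B: "12 / e < real B" using reals_Archimedean2 by blast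
      have "norm (1 - prob_unpackable {..<n} k (p n) (q n) - 1) < e"
        if n: "(max t\<^sub>0 B) ^ (100 * k) + 2 \<le> n" for n
      proof -
        obtain t where t: "t ^ (100 * k) \<le> n" "n < (t + 1) ^ (100 * k)"
          using ex_power_bracket[of "100 * k" n] k by auto
        have "max t\<^sub>0 B \<le> t"
        proof (rule ccontr)
          assume "\<not> ?thesis"
          hence "(t + 1) ^ (100 * k) \<le> (max t\<^sub>0 B) ^ (100 * k)" by (intro power_mono) auto
          thus False using t n by simp
        qed
        hence large: "large k \<delta> t" and tB: "B \<le> t" using t0 by auto
        have n2: "2 \<le> n" using n by simp
        have bound: "prob_unpackable {..<n} k p' q' \<le> 12 / t"
          if "0 < p'" "p' \<le> q'" "q' \<le> 1 - \<delta>" "p' * q' = p n * q n" for p' q'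
          using pq n2 by (intro prob_unpackable_le[OF k assms large t that(1-3)]) (simp add: that(4) s_def)
        have "prob_unpackable {..<n} k (p n) (q n) \<le> 12 / t"
        proof (cases "p n \<le> q n")
          case True
          thus ?thesis using pos le n2 by (intro bound) auto
        next
          case False
          hence "prob_unpackable {..<n} k (q n) (p n) \<le> 12 / t"
            using pos le n2 by (intro bound) auto
          thus ?thesis using prob_unpackable_commute[of "{..<n}" k "p n" "q n"] by simp
        qed
        also have "12 / real t < e"
        proof -
          have "12 / e < t" using B tB by simp
          moreover have "0 < real t" using large by (simp add: large_def)
          ultimately show ?thesis using e by (simp add: field_simps)
        qed
        finally show ?thesis by (simp add: prob_unpackable_def)
      qed
      thus "\<exists>n\<^sub>0. \<forall>n\<ge>n\<^sub>0. norm (1 - prob_unpackable {..<n} k (p n) (q n) - 1) < e" by blast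
    qed
    thus "(\<lambda>n. measure_pmf.prob
               (pair_pmf (random_hypergraph n k (p n)) (random_hypergraph n k (q n)))
               {(G\<^sub>1, G\<^sub>2). can_be_packed G\<^sub>1 G\<^sub>2}) \<longlonglongrightarrow> 1"
      by (simp only: prob_can_be_packed)
  qed
qed

end
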